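(* Let $m,m_1,m_2\in\mathbb N$ with $m_1\ge m_2\geq 1$, put $n=m_1m$, $d=m_2m$, let $U_m\in\mathbb C^{m,m}$ be unitary, and let $\mathcal M=\mathcal V(U_m)^{m_1,m_2}\cap \mathrm{St}(d,n)$. Then $\mathcal M$ is a (smooth, embedded) submanifold of the linear space $\mathcal V(U_m)^{m_1,m_2}$, and for every $C\in\mathcal M$ its tangent space is $$\mathcal T_C\mathcal M=\bigl\{CV+B:\ V\in\mathcal V(U_m)^{m_2,m_2},\ B\in\mathcal V(U_m)^{m_1,m_2},\ V^{\mathrm T}=-V,\ C^{\mathrm T}B=0\bigr\}=\mathcal V(U_m)^{m_1,m_2}\cap\mathcal T_C\mathrm{St}(d,n).$$ The orthogonal projection (with respect to the Frobenius inner product) of $X\in\mathcal V(U_m)^{m_1,m_2}$ onto $\mathcal T_C\mathcal M$ is given by $$\Pi_{\mathcal T_C\mathcal M}(X)=\Pi_{\mathcal T_C\mathrm{St}(d,n)}(X),$$ and a retraction on $\mathcal M$ is given by $$\mathcal R_{\mathcal T_C\mathcal M}(X)=\mathcal R_{\mathcal T_C\mathrm{St}(d,n)}(X),\qquad X\in\mathcal T_C\mathcal M,$$ where $\mathcal R_{\mathcal T_C\mathrm{St}(d,n)}$ is the Cayley-transform retraction on the Stiefel manifold. Further, extending $\mathcal R_{\mathcal T_C\mathcal M}$ by the same formula to all of $\mathcal V(U_m)^{m_1,m_2}$, we have $$\mathcal R_{\mathcal T_C\mathcal M}(X)=\mathcal R_{\mathcal T_C\mathrm{St}(d,n)}\bigl(\Pi_{\mathcal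 T_C\mathcal M}X\bigr)\qquad\text{for all }X\in\mathcal V(U_m)^{m_1,m_2}.$$
   Context: For a unitary matrix $U_m\in\mathbb C^{m,m}$, define the commutative matrix algebra $\mathcal A(U_m)=\{C=U_m\Lambda U_m^*\in\mathbb R^{m,m}:\Lambda\text{ complex diagonal matrix}\}$ (only real matrices of this form). For $p,q\in\mathbb N$, $\mathcal V(U_m)^{p,q}$ is the linear subspace of $\mathbb R^{pm,qm}$ of block matrices $C=(C_{ij})_{i=1,\dots,p;\,j=1,\dots,q}$ with all blocks $C_{ij}\in\mathcal A(U_m)$. For $n\ge d$, the Stiefel manifold is $\mathrm{St}(d,n)=\{T\in\mathbb R^{n,d}:T^{\mathrm T}T=I_d\}$, with tangent space $\mathcal T_T\mathrm{St}(d,n)=\{TV+B:\ V\in\mathbb R^{d,d},\ B\in\mathbb R^{n,d},\ V^{\mathrm T}=-V,\ T^{\mathrm T}B=0\}$ at $T$. The orthogonal projection of $X\in\mathbb R^{n,d}$ onto $\mathcal T_T\mathrm{St}(d,n)$ is $$\Pi_{\mathcal T_T\mathrm{St}(d,n)}X=(I_n-TT^{\mathrm T})X+\tfrac12T(T^{\mathrm T}X-X^{\mathrm T}T)=W(T,X)\,T,$$ where $W(T,X)=\hat W(T,X)-\hat W(T,X)^{\mathrm T}$ and $\hat W(T,X)=XT^{\mathrm T}-\tfrac12T(T^{\mathrm T}XT^{\mathrm T})$. The Cayley-transform retraction is $$\mathcal R_{\mathcal T_T\mathrm{St}(d,n)}(X)=\bigl(I_n-\tfrac12W(T,X)\bigr)^{-1}\bigl(I_n+\tfrac12W(T,X)\bigr)T;$$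 the formula makes sense for all $X\in\mathbb R^{n,d}$, not only for tangent $X$. A retraction on an embedded submanifold $\mathcal M$ is a smooth map $(C,X)\mapsto\mathcal R_{\mathcal T_C\mathcal M}(X)\in\mathcal M$ on the tangent bundle such that $\mathcal R_{\mathcal T_C\mathcal M}(0)=C$ and the differential of $\mathcal R_{\mathcal T_C\mathcal M}$ at $0$ is the identity of $\mathcal T_C\mathcal M$. *)

theory Defs
  imports "HOL-Analysis.Analysis"
begin

section \<open>Smooth maps and embedded submanifolds\<close>

text \<open>Only meant for open \<open>S\<close>: all partial derivatives up to order \<open>k\<close> exist as
  directional derivatives of Frechet derivatives and are continuous on \<open>S\<close>.\<close>

primrec Ck_on ::
  "nat \<Rightarrow> 'a::euclidean_space set \<Rightarrow> ('a \<Rightarrow> 'b::euclidean_space) \<Rightarrow> bool" where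
  "Ck_on 0 S f \<longleftrightarrow> continuous_on S f"
| "Ck_on (Suc k) S f \<longleftrightarrow>
     (\<forall>x\<in>S. f differentiable (at x)) \<and>
     (\<forall>v. Ck_on k S (\<lambda>x. frechet_derivative f (at x) v))"

text \<open>Smoothness on an arbitrary set \<open>A\<close> means having local smooth extensions to open subsets
  of the ambient space. For a relatively open subset of a linear subspace, and for an embedded
  submanifold (such as a tangent bundle), this is the intrinsic notion of a smooth map.\<close>

definition smooth_map_on ::
  "'a::euclidean_space set \<Rightarrow> ('a \<Rightarrow> 'b::euclidean_space) \<Rightarrow> bool" where
  "smooth_map_on A f \<longleftrightarrow>
     (\<forall>x\<in>A. \<exists>N g. open N \<and> x \<in> N \<and> (\<forall>k. Ck_on k N g) \<and> (\<forall>y\<in>A \<inter> N. f y = g y))"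

definition diffeomorphism ::
  "'a::euclidean_space set \<Rightarrow> 'b::euclidean_space set \<Rightarrow> ('a \<Rightarrow> 'b) \<Rightarrow> ('b \<Rightarrow> 'a) \<Rightarrow> bool" where
  "diffeomorphism A B \<phi> \<psi> \<longleftrightarrow>
     homeomorphism A B \<phi> \<psi> \<and> smooth_map_on A \<phi> \<and> smooth_map_on B \<psi>"

text \<open>\<open>M\<close> is a smooth embedded submanifold of the linear space \<open>V\<close>: near each of its points, a
  diffeomorphism between open subsets of \<open>V\<close> flattens \<open>M\<close> to a linear subspace, whose
  dimension does not depend on the point.\<close>

definition embedded_submanifold :: "'a::euclidean_space set \<Rightarrow> 'a set \<Rightarrow> bool" where
  "embedded_submanifold V M \<longleftrightarrow>
     subspace V \<and> M \<subseteq> V \<and>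
     (\<exists>k. \<forall>x\<in>M. \<exists>N N' \<phi> \<psi> L.
        openin (top_of_set V) N \<and> x \<in> N \<and> openin (top_of_set V) N' \<and>
        diffeomorphism N N' \<phi> \<psi> \<and>
        subspace L \<and> L \<subseteq> V \<and> dim L = k \<and>
        \<phi> ` (M \<inter> N) = L \<inter> N')"

text \<open>Velocities at \<open>x\<close> of smooth curves in \<open>M\<close> through \<open>x\<close>.\<close>

definition tangent_space :: "'a::euclidean_space set \<Rightarrow> 'a \<Rightarrow> 'a set" where
  "tangent_space M x =
     {v. \<exists>c e. 0 < e \<and> smooth_map_on {-e<..<e::real} c \<and> c ` {-e<..<e} \<subseteq> M \<and>
           c 0 = x \<and> (c has_vector_derivative v) (at 0)}"

definition tangent_bundle :: "'a::euclidean_space set \<Rightarrow> ('a \<times> 'a) set" where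
  "tangent_bundle M = {(x, v). x \<in> M \<and> v \<in> tangent_space M x}"

text \<open>The derivative is taken within the tangent space, i.e. it is the differential of the
  restriction of \<open>R x\<close> to that space. Values of \<open>R\<close> outside the tangent bundle are irrelevant.\<close>

definition manifold_retraction :: "'a::euclidean_space set \<Rightarrow> ('a \<Rightarrow> 'a \<Rightarrow> 'a) \<Rightarrow> bool" where
  "manifold_retraction M R \<longleftrightarrow>
     smooth_map_on (tangent_bundle M) (\<lambda>(x, v). R x v) \<and>
     (\<forall>x\<in>M. \<forall>v\<in>tangent_space M x. R x v \<in> M) \<and>
     (\<forall>x\<in>M. R x 0 = x) \<and>
     (\<forall>x\<in>M. (R x has_derivative (\<lambda>v. v)) (at 0 within tangent_space M x))"

text \<open>On matrices \<open>real^'d^'n\<close> the library's inner product is the Frobenius inner product.\<close>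

definition orth_proj :: "'a::euclidean_space set \<Rightarrow> 'a \<Rightarrow> 'a" where
  "orth_proj S x = (THE y. y \<in> S \<and> (\<forall>z\<in>S. orthogonal (x - y) z))"


section \<open>The matrix spaces\<close>

definition ctranspose :: "complex^'c^'r \<Rightarrow> complex^'r^'c" where
  "ctranspose A = map_matrix cnj (transpose A)"

definition unitary_matrix :: "complex^'m^'m \<Rightarrow> bool" where
  "unitary_matrix U \<longleftrightarrow> ctranspose U ** U = mat 1 \<and> U ** ctranspose U = mat 1"

definition diagonal_matrix :: "'a::zero^'m^'m \<Rightarrow> bool" where
  "diagonal_matrix D \<longleftrightarrow> (\<forall>i j. i \<noteq> j \<longrightarrow> D $ i $ j = 0)"

definition diag_algebra :: "complex^'m^'m \<Rightarrow> (real^'m^'m) set" where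
  "diag_algebra U =
     {C. \<exists>D. diagonal_matrix D \<and> map_matrix complex_of_real C = U ** D ** ctranspose U}"

text \<open>Matrices with \<open>p\<close> by \<open>q\<close> blocks of size \<open>m\<close> by \<open>m\<close>: the rows are indexed by pairs
  (block row, row within the block), so there are \<open>CARD('p) * CARD('m)\<close> of them, and similarly
  for the columns.\<close>

definition block ::
  "real^('q::finite \<times> 'm::finite)^('p::finite \<times> 'm) \<Rightarrow> 'p \<Rightarrow> 'q \<Rightarrow> real^'m^'m" where
  "block C i j = (\<chi> a b. C $ (i, a) $ (j, b))"

definition block_space ::
  "complex^'m^'m \<Rightarrow> (real^('q::finite \<times> 'm)^('p::finite \<times> 'm)) set" where
  "block_space U = {C. \<forall>i j. block C i j \<in> diag_algebra U}"


section \<open>The Stiefel manifold\<close>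

definition stiefel :: "(real^'d^'n) set" where
  "stiefel = {T. transpose T ** T = mat 1}"

definition stiefel_tangent :: "real^'d^'n \<Rightarrow> (real^'d^'n) set" where
  "stiefel_tangent T =
     {T ** V + B | (V::real^'d^'d) B. transpose V = - V \<and> transpose T ** B = 0}"

definition stiefel_proj :: "real^'d^'n \<Rightarrow> real^'d^'n \<Rightarrow> real^'d^'n" where
  "stiefel_proj T X =
     (mat 1 - T ** transpose T) ** X + (1/2) *\<^sub>R (T ** (transpose T ** X - transpose X ** T))"

definition cayley_W_hat :: "real^'d^'n \<Rightarrow> real^'d^'n \<Rightarrow> real^'n^'n" where
  "cayley_W_hat T X =
     X ** transpose T - (1/2) *\<^sub>R (T ** (transpose T ** X ** transpose T))"

definition cayley_W :: "real^'d^'n \<Rightarrow> real^'d^'n \<Rightarrow> real^'n^'n" where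
  "cayley_W T X = cayley_W_hat T X - transpose (cayley_W_hat T X)"

text \<open>\<open>cayley_W T X\<close> is skew-symmetric, so the inverse below exists for all \<open>T\<close> and \<open>X\<close>.\<close>

definition cayley_retraction :: "real^'d^'n \<Rightarrow> real^'d^'n \<Rightarrow> real^'d^'n" where
  "cayley_retraction T X =
     matrix_inv (mat 1 - (1/2) *\<^sub>R cayley_W T X) ** (mat 1 + (1/2) *\<^sub>R cayley_W T X) ** T"

lemma transpose_cayley_W: "transpose (cayley_W T X) = - cayley_W T X"
  by (simp add: cayley_W_def transpose_def vec_eq_iff)

lemma stiefel_proj_eq_cayley_W:
  fixes T X :: "real^'d^'n"
  assumes "T \<in> stiefel"
  shows "stiefel_proj T X = cayley_W T X ** T"
proof -
  have T: "transpose T ** T = mat 1"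
    using assms by (simp add: stiefel_def)
  have tr: "transpose (A - B) = transpose A - transpose B"
    and ts: "transpose (c *\<^sub>R A) = c *\<^sub>R transpose A" for A B :: "real^'n^'n" and c
    by (simp_all add: transpose_def vec_eq_iff)
  have ml: "(A - B) ** Y = A ** Y - B ** Y"
    and sl: "(c *\<^sub>R A) ** Y = c *\<^sub>R (A ** Y)" for A B :: "real^'n^'n" and Y :: "real^'d^'n" and c
    by (simp_all add: matrix_matrix_mult_def vec_eq_iff sum_subtractf sum_distrib_left
        algebra_simps)
  have mr: "T ** (A - B) = T ** A - T ** B" for A B :: "real^'d^'d"
    by (simp add: matrix_matrix_mult_def vec_eq_iff sum_subtractf algebra_simps)
  have TT: "Y ** transpose T ** T = Y" for Y :: "real^'d^'n"
    using T by (metis matrix_mul_assoc matrix_mul_rid)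
  have "T ** (transpose T ** X ** transpose T) ** T = T ** (transpose T ** X)"
    using T by (metis matrix_mul_assoc matrix_mul_rid)
  moreover have "transpose (T ** (transpose T ** X ** transpose T)) ** T = T ** (transpose X ** T)"
    using T by (simp add: matrix_transpose_mul matrix_mul_assoc TT)
  moreover have "transpose (X ** transpose T) ** T = T ** (transpose X ** T)"
    by (simp add: matrix_transpose_mul matrix_mul_assoc)
  ultimately have "cayley_W T X ** T =
      X - (1/2) *\<^sub>R (T ** (transpose T ** X)) - (1/2) *\<^sub>R (T ** (transpose X ** T))"
    unfolding cayley_W_def cayley_W_hat_def tr ts ml sl TT
    by (simp add: vec_eq_iff)
  moreover have "stiefel_proj T X =
      X - (1/2) *\<^sub>R (T ** (transpose T ** X)) - (1/2) *\<^sub>R (T ** (transpose X ** T))"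
    unfolding stiefel_proj_def ml mr by (simp add: vec_eq_iff matrix_mul_assoc field_simps)
  ultimately show ?thesis by simp
qed

end

theory Submission
  imports Defs
begin

text \<open>Block matrices whose blocks lie in the algebra of \<open>U\<close> are closed under sums, products and
  transposes and contain the identity; since the square ones form a finite-dimensional algebra, they
  are also closed under inverses (\<open>block_space_matrix_inv\<close>). Hence every construction on the Stiefel
  manifold by a formula that uses these operations only restricts to the block matrices. The
  projection and the Cayley retraction are given by such formulas.

  The same principle yields the submanifold property once the Stiefel manifold has a straightening
  chart of this kind. Orthonormalisation by a matrix square root is not one, because a square root
  is not a rational expression. Instead, around \<open>C\<close> a rational diffeomorphism is used that
  generalises both the Cayley transform of the orthogonal group and the stereographic projection of
  the sphere (\<open>stiefel_chart\<close>). Under it the equation \<open>transpose T ** T = mat 1\<close> becomes the linear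
  condition that \<open>transpose C ** Y\<close> is skew-symmetric (\<open>stiefel_iff_stiefel_chart_skew\<close>), so the
  chart maps the block Stiefel manifold to the linear space \<open>skew_tangent V C\<close>, which turns out to
  be the tangent space. Its dimension is independent of \<open>C\<close> because its orthogonal complement in
  \<open>V\<close> is a copy of the symmetric block matrices (\<open>dim_skew_tangent\<close>).

  Smoothness of all maps reduces to that of the matrix inverse, which follows from Cramer's rule
  (\<open>Cinf_on_matrix_inv\<close>). The projection is orthogonal because \<open>X - stiefel_proj C X\<close> has the form
  \<open>C ** S\<close> with \<open>S\<close> symmetric, and such matrices are orthogonal to the tangent space. The map
  \<open>cayley_W C\<close> vanishes on them, so the retraction takes the same value at \<open>X\<close> and at its
  projection.\<close>

section \<open>Calculus of smooth maps\<close>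

lemma Ck_on_cong:
  assumes "open S" and "\<And>x. x \<in> S \<Longrightarrow> f x = g x"
  shows "Ck_on k S f \<longleftrightarrow> Ck_on k S g"
  using assms(2)
proof (induction k arbitrary: f g)
  case 0
  then show ?case by (simp cong: continuous_on_cong)
next
  case (Suc k)
  have deriv: "(f has_derivative D) (at x) \<longleftrightarrow> (g has_derivative D) (at x)" if "x \<in> S" for x D
    using has_derivative_transform_within_open[of f D x UNIV S g]
      has_derivative_transform_within_open[of g D x UNIV S f] assms(1) that Suc.prems
    by auto
  have "frechet_derivative f (at x) = frechet_derivative g (at x)" if "x \<in> S" for x
    unfolding frechet_derivative_def using deriv[OF that] by simp
  then have "Ck_on k S (\<lambda>x. frechet_derivative f (at x) v) \<longleftrightarrow>
      Ck_on k S (\<lambda>x. frechet_derivative g (at x) v)" for v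
    by (intro Suc.IH) simp
  then show ?case
    using deriv by (auto simp: differentiable_def)
qed

text \<open>Any family of derivatives on the open set may stand in for the Frechet derivative operator,
  so that the product and quotient rules give the next order by induction.\<close>

lemma Ck_on_SucI:
  assumes "open S" and "\<And>x. x \<in> S \<Longrightarrow> (f has_derivative f' x) (at x)"
    and "\<And>v. Ck_on k S (\<lambda>x. f' x v)"
  shows "Ck_on (Suc k) S f"
proof -
  have "Ck_on k S (\<lambda>x. frechet_derivative f (at x) v)" for v
    using assms(3)[of v] by (subst Ck_on_cong[OF assms(1), where g = "\<lambda>x. f' x v"])
      (simp_all add: frechet_derivative_at[OF assms(2), symmetric])
  then show ?thesis
    using assms(2) by (auto simp: differentiable_def)
qed

lemma Ck_on_Suc_has_derivative:
  "Ck_on (Suc k) S f \<Longrightarrow> x \<in> S \<Longrightarrow> (f has_derivative frechet_derivative f (at x)) (at x)"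
  by (simp add: frechet_derivative_works)

lemma Ck_on_Suc_imp: "Ck_on (Suc k) S f \<Longrightarrow> Ck_on k S f"
proof (induction k arbitrary: f)
  case 0
  then show ?case
    by (simp add: continuous_at_imp_continuous_on differentiable_imp_continuous_within)
next
  case (Suc k)
  then show ?case by (metis Ck_on.simps(2))
qed

lemma Ck_on_const:
  assumes "open S"
  shows "Ck_on k S (\<lambda>x. c)"
proof (induction k arbitrary: c)
  case (Suc k)
  show ?case
    by (rule Ck_on_SucI[OF assms has_derivative_const Suc.IH])
qed simp

lemma Ck_on_linear_compose:
  assumes "open S" and "bounded_linear h" and "Ck_on k S f"
  shows "Ck_on k S (\<lambda>x. h (f x))"
  using assms(3)
proof (induction k arbitrary: f)
  case 0
  then show ?case
    using assms(2) by (simp add: bounded_linear.continuous_on)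
next
  case (Suc k)
  show ?case
    by (rule Ck_on_SucI[OF assms(1)
          bounded_linear.has_derivative[OF assms(2) Ck_on_Suc_has_derivative[OF Suc.prems]]])
      (use Suc in auto)
qed

lemma Ck_on_id: "open S \<Longrightarrow> Ck_on k S (\<lambda>x. x)"
proof (cases k)
  case (Suc j)
  assume "open S"
  then show ?thesis
    unfolding Suc by (intro Ck_on_SucI[OF _ has_derivative_ident Ck_on_const])
qed simp

lemma Ck_on_add:
  assumes "open S" and "Ck_on k S f" and "Ck_on k S g"
  shows "Ck_on k S (\<lambda>x. f x + g x)"
  using assms(2,3)
proof (induction k arbitrary: f g)
  case 0
  then show ?case by (simp add: continuous_on_add)
next
  case (Suc k)
  show ?case
    by (rule Ck_on_SucI[OF assms(1) has_derivative_add[OF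
          Ck_on_Suc_has_derivative[OF Suc.prems(1)] Ck_on_Suc_has_derivative[OF Suc.prems(2)]]])
      (use Suc in auto)
qed

lemma Ck_on_bilinear:
  assumes "open S" and "bounded_bilinear h" and "Ck_on k S f" and "Ck_on k S g"
  shows "Ck_on k S (\<lambda>x. h (f x) (g x))"
  using assms(3,4)
proof (induction k arbitrary: f g)
  case 0
  then show ?case
    using assms(2) by (simp add: bounded_bilinear.continuous_on)
next
  case (Suc k)
  show ?case
  proof (rule Ck_on_SucI[OF assms(1) bounded_bilinear.FDERIV[OF assms(2)
          Ck_on_Suc_has_derivative[OF Suc.prems(1)] Ck_on_Suc_has_derivative[OF Suc.prems(2)]]])
    show "Ck_on k S (\<lambda>x. h (f x) (frechet_derivative g (at x) v) +
        h (frechet_derivative f (at x) v) (g x))" for v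
      by (intro Ck_on_add assms(1) Suc.IH Suc.prems[THEN Ck_on_Suc_imp])
        (use Suc.prems in auto)
  qed
qed

lemma Ck_on_inverse:
  fixes f :: "'a::euclidean_space \<Rightarrow> real"
  assumes "open S" and nz: "\<And>x. x \<in> S \<Longrightarrow> f x \<noteq> 0" and "Ck_on k S f"
  shows "Ck_on k S (\<lambda>x. inverse (f x))"
  using assms(3)
proof (induction k)
  case 0
  then show ?case
    using nz by (simp add: continuous_on_inverse)
next
  case (Suc k)
  note mult = Ck_on_bilinear[OF assms(1) bounded_bilinear_mult]
  show ?case
  proof (rule Ck_on_SucI[OF assms(1)
        Deriv.has_derivative_inverse[OF nz Ck_on_Suc_has_derivative[OF Suc.prems]]])
    have inv: "Ck_on k S (\<lambda>x. inverse (f x))"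
      using Suc Ck_on_Suc_imp by blast
    show "Ck_on k S (\<lambda>x. - (inverse (f x) * frechet_derivative f (at x) v * inverse (f x)))" for v
      by (rule Ck_on_linear_compose[OF assms(1) bounded_linear_minus[OF bounded_linear_ident]],
          intro mult inv) (use Suc.prems in auto)
  qed assumption+
qed

text \<open>Openness is built in because the calculus rules of \<open>Ck_on\<close> need it; the rules for sums and
  products then chain without side conditions.\<close>

definition Cinf_on :: "'a::euclidean_space set \<Rightarrow> ('a \<Rightarrow> 'b::euclidean_space) \<Rightarrow> bool" where
  "Cinf_on S f \<longleftrightarrow> open S \<and> (\<forall>k. Ck_on k S f)"

lemma Cinf_on_const: "open S \<Longrightarrow> Cinf_on S (\<lambda>x. c)"
  by (simp add: Cinf_on_def Ck_on_const)

lemma Cinf_on_id: "open S \<Longrightarrow> Cinf_on S (\<lambda>x. x)"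
  by (simp add: Cinf_on_def Ck_on_id)

lemma Cinf_on_linear: "bounded_linear h \<Longrightarrow> Cinf_on S f \<Longrightarrow> Cinf_on S (\<lambda>x. h (f x))"
  by (simp add: Cinf_on_def Ck_on_linear_compose)

lemma Cinf_on_add: "Cinf_on S f \<Longrightarrow> Cinf_on S g \<Longrightarrow> Cinf_on S (\<lambda>x. f x + g x)"
  by (simp add: Cinf_on_def Ck_on_add)

lemma Cinf_on_scaleR: "Cinf_on S f \<Longrightarrow> Cinf_on S (\<lambda>x. c *\<^sub>R f x)"
  by (rule Cinf_on_linear[OF bounded_linear_scaleR_right])

lemma Cinf_on_diff: "Cinf_on S f \<Longrightarrow> Cinf_on S g \<Longrightarrow> Cinf_on S (\<lambda>x. f x - g x)"
  using Cinf_on_add[of S f "\<lambda>x. - 1 *\<^sub>R g x"] Cinf_on_scaleR[of S g "- 1"] by simp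

lemma Cinf_on_bilinear:
  "bounded_bilinear h \<Longrightarrow> Cinf_on S f \<Longrightarrow> Cinf_on S g \<Longrightarrow> Cinf_on S (\<lambda>x. h (f x) (g x))"
  by (simp add: Cinf_on_def Ck_on_bilinear)

lemma Cinf_on_mult:
  fixes f g :: "'a::euclidean_space \<Rightarrow> real"
  shows "Cinf_on S f \<Longrightarrow> Cinf_on S g \<Longrightarrow> Cinf_on S (\<lambda>x. f x * g x)"
  by (rule Cinf_on_bilinear[OF bounded_bilinear_mult])

lemma Cinf_on_divide:
  fixes f g :: "'a::euclidean_space \<Rightarrow> real"
  assumes "Cinf_on S f" "Cinf_on S g" "\<And>x. x \<in> S \<Longrightarrow> g x \<noteq> 0"
  shows "Cinf_on S (\<lambda>x. f x / g x)"
  unfolding divide_inverse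
  using assms by (intro Cinf_on_mult) (auto simp: Cinf_on_def Ck_on_inverse)

lemma Cinf_on_sum:
  assumes "open S" and "\<And>i. i \<in> I \<Longrightarrow> Cinf_on S (f i)"
  shows "Cinf_on S (\<lambda>x. \<Sum>i\<in>I. f i x)"
  using assms(2)
  by (induction I rule: infinite_finite_induct)
    (simp_all add: Cinf_on_const[OF assms(1)] Cinf_on_add)

lemma Cinf_on_prod:
  fixes f :: "'i \<Rightarrow> 'a::euclidean_space \<Rightarrow> real"
  assumes "open S" and "\<And>i. i \<in> I \<Longrightarrow> Cinf_on S (f i)"
  shows "Cinf_on S (\<lambda>x. \<Prod>i\<in>I. f i x)"
  using assms(2)
  by (induction I rule: infinite_finite_induct)
    (simp_all add: Cinf_on_const[OF assms(1)] Cinf_on_mult)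

lemma Cinf_on_nth: "Cinf_on S f \<Longrightarrow> Cinf_on S (\<lambda>x. f x $ i)"
  by (rule Cinf_on_linear[OF bounded_linear_vec_nth])

text \<open>Together with \<open>Cinf_on_nth\<close>, this reduces the smoothness of a matrix-valued
  map to that of its entries.\<close>

lemma Cinf_on_vec:
  fixes f :: "'a::euclidean_space \<Rightarrow> 'b::euclidean_space^'n"
  assumes "open S" and "\<And>i. Cinf_on S (\<lambda>x. f x $ i)"
  shows "Cinf_on S f"
proof -
  have "bounded_linear (axis i :: 'b \<Rightarrow> 'b^'n)" for i
    by (intro linear_conv_bounded_linear[THEN iffD1] linearI) (auto simp: vec_eq_iff axis_def)
  then have "Cinf_on S (\<lambda>x. \<Sum>i\<in>UNIV. axis i (f x $ i))"
    by (intro Cinf_on_sum Cinf_on_linear[where h = "axis _"] assms)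
  moreover have "(\<Sum>i\<in>UNIV. axis i (y $ i)) = y" for y :: "'b^'n"
    by (simp add: vec_eq_iff axis_def)
  ultimately show ?thesis by simp
qed

lemma Cinf_on_det:
  fixes A :: "'a::euclidean_space \<Rightarrow> real^'n^'n"
  assumes "open S" and "\<And>i j. Cinf_on S (\<lambda>x. A x $ i $ j)"
  shows "Cinf_on S (\<lambda>x. det (A x))"
  unfolding det_def using assms
  by (intro Cinf_on_sum Cinf_on_mult Cinf_on_const Cinf_on_prod)

lemma matrix_inv_cancel:
  fixes A :: "'a::semiring_1^'n^'m"
  assumes "invertible A"
  shows "A ** matrix_inv A = mat 1" "matrix_inv A ** A = mat 1"
  using assms someI_ex[of "\<lambda>B. A ** B = mat 1 \<and> B ** A = mat 1"]
  unfolding matrix_inv_def invertible_def by auto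

text \<open>Cramer's rule, applied to the equation that determines the \<open>l\<close>-th column of the inverse.\<close>

lemma matrix_inv_nth:
  fixes A :: "real^'n^'n"
  assumes "invertible A"
  shows "matrix_inv A $ k $ l = det (\<chi> i j. if j = k then mat 1 $ i $ l else A $ i $ j) / det A"
proof -
  let ?col = "\<lambda>B. (\<chi> i. B $ i $ l) :: real^'n"
  have "A *v ?col (matrix_inv A) = ?col (A ** matrix_inv A)"
    by (simp add: matrix_vector_mult_def matrix_matrix_mult_def)
  then have "A *v ?col (matrix_inv A) = ?col (mat 1)"
    using matrix_inv_cancel(1)[OF assms] by simp
  then have "?col (matrix_inv A) =
      (\<chi> k. det (\<chi> i j. if j = k then ?col (mat 1) $ i else A $ i $ j) / det A)"
    by (rule cramer[OF invertible_det_nz[THEN iffD1, OF assms], THEN iffD1])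
  from arg_cong[OF this, of "\<lambda>v. v $ k"] show ?thesis
    by (simp cong: if_cong)
qed

text \<open>By Cramer's rule the entries of the inverse are quotients of polynomials in the entries.\<close>

lemma Cinf_on_matrix_inv:
  fixes A :: "'a::euclidean_space \<Rightarrow> real^'n^'n"
  assumes A: "Cinf_on S A" and inv: "\<And>x. x \<in> S \<Longrightarrow> invertible (A x)"
  shows "Cinf_on S (\<lambda>x. matrix_inv (A x))"
proof -
  have S: "open S"
    using A by (simp add: Cinf_on_def)
  have entry: "Cinf_on S (\<lambda>x. A x $ i $ j)" for i j
    by (intro Cinf_on_nth A)
  have "Cinf_on S (\<lambda>x. matrix_inv (A x) $ k $ l)" for k l
  proof -
    have "Cinf_on S (\<lambda>x. det (\<chi> i j. if j = k then mat 1 $ i $ l else A x $ i $ j) / det (A x))"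
    proof (intro Cinf_on_divide Cinf_on_det S entry)
      show "Cinf_on S (\<lambda>x. (\<chi> i j. if j = k then mat 1 $ i $ l else A x $ i $ j) $ i $ j)" for i j
        using entry Cinf_on_const[OF S] by (cases "j = k") simp_all
      show "det (A x) \<noteq> 0" if "x \<in> S" for x
        using inv[OF that] invertible_det_nz by blast
    qed
    then show ?thesis
      unfolding Cinf_on_def
      by (subst Ck_on_cong[OF S matrix_inv_nth[OF inv]]) simp_all
  qed
  then show ?thesis
    by (intro Cinf_on_vec S)
qed

lemma bounded_bilinear_matrix_mult:
  "bounded_bilinear (\<lambda>(A::real^'n^'m) (B::real^'p^'n). A ** B)"
  unfolding bilinear_conv_bounded_bilinear[symmetric] bilinear_def
  by (auto intro!: linearI simp: matrix_matrix_mult_def vec_eq_iff sum.distrib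
      sum_distrib_left algebra_simps)

lemma bounded_linear_transpose: "bounded_linear (transpose :: real^'n^'m \<Rightarrow> _)"
  by (intro linear_conv_bounded_linear[THEN iffD1] linearI) (auto simp: vec_eq_iff transpose_def)

lemmas Cinf_on_matrix_mult = Cinf_on_bilinear[OF bounded_bilinear_matrix_mult]

lemmas Cinf_on_transpose = Cinf_on_linear[OF bounded_linear_transpose]

lemma smooth_map_on_if_Cinf_on: "Cinf_on N f \<Longrightarrow> A \<subseteq> N \<Longrightarrow> smooth_map_on A f"
  unfolding smooth_map_on_def Cinf_on_def by blast

lemma Cinf_on_imp_continuous_on: "Cinf_on S f \<Longrightarrow> continuous_on S f"
  unfolding Cinf_on_def using Ck_on.simps(1) by blast

lemma Cinf_on_imp_differentiable: "Cinf_on S f \<Longrightarrow> x \<in> S \<Longrightarrow> f differentiable (at x)"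
  unfolding Cinf_on_def using Ck_on.simps(2) by blast

section \<open>Matrix algebra\<close>

lemmas matrix_mult_add_left = bounded_bilinear.add_left[OF bounded_bilinear_matrix_mult]
lemmas matrix_mult_add_right = bounded_bilinear.add_right[OF bounded_bilinear_matrix_mult]
lemmas matrix_mult_diff_left = bounded_bilinear.diff_left[OF bounded_bilinear_matrix_mult]
lemmas matrix_mult_diff_right = bounded_bilinear.diff_right[OF bounded_bilinear_matrix_mult]
lemmas matrix_mult_minus_left = bounded_bilinear.minus_left[OF bounded_bilinear_matrix_mult]
lemmas matrix_mult_minus_right = bounded_bilinear.minus_right[OF bounded_bilinear_matrix_mult]
lemmas matrix_mult_scaleR_left = bounded_bilinear.scaleR_left[OF bounded_bilinear_matrix_mult]
lemmas matrix_mult_scaleR_right = bounded_bilinear.scaleR_right[OF bounded_bilinear_matrix_mult]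
lemmas transpose_add = linear_add[OF bounded_linear.linear[OF bounded_linear_transpose]]
lemmas transpose_diff = linear_diff[OF bounded_linear.linear[OF bounded_linear_transpose]]
lemmas transpose_minus = linear_neg[OF bounded_linear.linear[OF bounded_linear_transpose]]
lemmas transpose_zero = linear_0[OF bounded_linear.linear[OF bounded_linear_transpose]]

text \<open>These rules bring a matrix expression into the form of a linear combination of products nested
  to the right, in which transposes occur at single factors only. Two sides of an identity can then
  be compared entrywise.\<close>

lemmas matrix_expand =
  matrix_mult_add_left matrix_mult_add_right matrix_mult_diff_left matrix_mult_diff_right
  matrix_mult_minus_left matrix_mult_minus_right matrix_mult_scaleR_left matrix_mult_scaleR_right
  transpose_add transpose_diff transpose_minus transpose_scalar matrix_transpose_mul
  matrix_mul_assoc[symmetric]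

lemma invertible_matrix_inv: "invertible A \<Longrightarrow> invertible (matrix_inv A)"
  for A :: "'a::semiring_1^'n^'m"
  using matrix_inv_cancel unfolding invertible_def by blast

lemma matrix_inv_unique:
  fixes A B :: "real^'n^'n"
  assumes "A ** B = mat 1"
  shows "matrix_inv A = B"
proof -
  have "invertible A"
    using assms invertible_right_inverse by blast
  then have "matrix_inv A ** (A ** B) = B"
    by (metis matrix_inv_cancel(2) matrix_mul_assoc matrix_mul_lid)
  then show ?thesis
    using assms by simp
qed

lemma invertible_mult_left_cancel:
  fixes A :: "real^'n^'n"
  assumes "invertible A"
  shows "A ** B = A ** C \<longleftrightarrow> B = C"
  by (metis assms matrix_inv_cancel(2) matrix_mul_assoc matrix_mul_lid)

lemma inner_matrix_mult_right: "(A ** B) \<bullet> C = B \<bullet> (transpose A ** C)"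
  for A :: "real^'n^'m" and B :: "real^'p^'n"
proof -
  have "(A ** B) \<bullet> C = (\<Sum>i\<in>UNIV. \<Sum>j\<in>UNIV. \<Sum>k\<in>UNIV. A$i$k * B$k$j * C$i$j)"
    by (simp add: inner_vec_def matrix_matrix_mult_def sum_distrib_right)
  also have "\<dots> = (\<Sum>i\<in>UNIV. \<Sum>k\<in>UNIV. \<Sum>j\<in>UNIV. A$i$k * B$k$j * C$i$j)"
    by (intro sum.cong refl, subst sum.swap) simp
  also have "\<dots> = (\<Sum>k\<in>UNIV. \<Sum>i\<in>UNIV. \<Sum>j\<in>UNIV. A$i$k * B$k$j * C$i$j)"
    by (rule sum.swap)
  also have "\<dots> = (\<Sum>k\<in>UNIV. \<Sum>j\<in>UNIV. \<Sum>i\<in>UNIV. A$i$k * B$k$j * C$i$j)"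
    by (intro sum.cong refl, subst sum.swap) simp
  also have "\<dots> = B \<bullet> (transpose A ** C)"
    by (simp add: inner_vec_def matrix_matrix_mult_def sum_distrib_left transpose_def mult_ac)
  finally show ?thesis .
qed

lemma inner_transpose: "transpose A \<bullet> transpose B = A \<bullet> B" for A B :: "real^'n^'m"
  unfolding inner_vec_def transpose_def by simp (rule sum.swap)

text \<open>This is why the matrices \<open>C ** S\<close> with \<open>S\<close> symmetric are normal to the Stiefel manifold
  at \<open>C\<close>.\<close>

lemma inner_symmetric_skew:
  fixes S V :: "real^'n^'n"
  assumes "transpose S = S" and "transpose V = - V"
  shows "S \<bullet> V = 0"
  using inner_transpose[of S V] assms by simp

section \<open>Block matrices over a simultaneously diagonalised algebra\<close>

lemma ctranspose_mult: "ctranspose (A ** B) = ctranspose B ** ctranspose A"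
  by (simp add: ctranspose_def map_matrix_def transpose_def matrix_matrix_mult_def vec_eq_iff
      cnj_sum mult.commute)

lemma ctranspose_ctranspose: "ctranspose (ctranspose A) = A"
  by (simp add: ctranspose_def map_matrix_def transpose_def vec_eq_iff)

lemma map_matrix_of_real:
  "map_matrix complex_of_real (A + B) = map_matrix complex_of_real A + map_matrix complex_of_real B"
  "map_matrix complex_of_real (c *\<^sub>R A) = c *\<^sub>R map_matrix complex_of_real A"
  "map_matrix complex_of_real (A ** D) = map_matrix complex_of_real A ** map_matrix complex_of_real D"
  "map_matrix complex_of_real (transpose A) = ctranspose (map_matrix complex_of_real A)"
  "map_matrix complex_of_real (mat 1) = mat 1"
  "map_matrix complex_of_real 0 = 0"
proof -
  have "complex_of_real (c * x) = c *\<^sub>R complex_of_real x" for x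
    by (simp add: scaleR_conv_of_real)
  then show "map_matrix complex_of_real (c *\<^sub>R A) = c *\<^sub>R map_matrix complex_of_real A"
    by (simp add: map_matrix_def vec_eq_iff del: of_real_mult)
qed (simp_all add: map_matrix_def vec_eq_iff matrix_matrix_mult_def ctranspose_def transpose_def
      mat_def)

lemma subspace_diag_algebra: "subspace (diag_algebra U)"
proof (rule subspaceI)
  have "diagonal_matrix 0 \<and> map_matrix complex_of_real 0 = U ** 0 ** ctranspose U"
    by (simp add: diagonal_matrix_def map_matrix_of_real matrix_matrix_mult_def vec_eq_iff)
  then show "0 \<in> diag_algebra U"
    unfolding diag_algebra_def by blast
next
  fix A B assume "A \<in> diag_algebra U" "B \<in> diag_algebra U"
  then obtain D E where "diagonal_matrix D" "map_matrix complex_of_real A = U ** D ** ctranspose U"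
    "diagonal_matrix E" "map_matrix complex_of_real B = U ** E ** ctranspose U"
    unfolding diag_algebra_def by blast
  then have "diagonal_matrix (D + E) \<and>
      map_matrix complex_of_real (A + B) = U ** (D + E) ** ctranspose U"
    by (simp add: diagonal_matrix_def map_matrix_of_real matrix_matrix_mult_def vec_eq_iff
        sum.distrib algebra_simps)
  then show "A + B \<in> diag_algebra U"
    unfolding diag_algebra_def by blast
next
  fix c A assume "A \<in> diag_algebra U"
  then obtain D where "diagonal_matrix D" "map_matrix complex_of_real A = U ** D ** ctranspose U"
    unfolding diag_algebra_def by blast
  then have "diagonal_matrix (c *\<^sub>R D) \<and>
      map_matrix complex_of_real (c *\<^sub>R A) = U ** (c *\<^sub>R D) ** ctranspose U"
    by (simp add: diagonal_matrix_def map_matrix_of_real matrix_scalar_ac scalar_matrix_assoc)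
  then show "c *\<^sub>R A \<in> diag_algebra U"
    unfolding diag_algebra_def by blast
qed

lemma diag_algebra_mult:
  assumes U: "unitary_matrix U" and "A \<in> diag_algebra U" and "B \<in> diag_algebra U"
  shows "A ** B \<in> diag_algebra U"
proof -
  obtain D E where D: "diagonal_matrix D" "map_matrix complex_of_real A = U ** D ** ctranspose U"
    and E: "diagonal_matrix E" "map_matrix complex_of_real B = U ** E ** ctranspose U"
    using assms(2,3) unfolding diag_algebra_def by blast
  have "D $ i $ k * E $ k $ j = 0" if "i \<noteq> j" for i j k
    using D(1) E(1) that unfolding diagonal_matrix_def by (cases "i = k") auto
  then have "diagonal_matrix (D ** E)"
    by (auto simp add: diagonal_matrix_def matrix_matrix_mult_def intro!: sum.neutral)
  moreover have "map_matrix complex_of_real (A ** B) = U ** (D ** E) ** ctranspose U"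
  proof -
    have "map_matrix complex_of_real (A ** B) =
        U ** D ** (ctranspose U ** U) ** E ** ctranspose U"
      by (simp add: map_matrix_of_real D(2) E(2) matrix_mul_assoc)
    also have "ctranspose U ** U = mat 1"
      using U by (simp add: unitary_matrix_def)
    finally show ?thesis
      by (simp add: matrix_mul_assoc)
  qed
  ultimately show ?thesis
    unfolding diag_algebra_def by blast
qed

text \<open>The transpose of a real matrix is its conjugate transpose, and conjugate transposition of
  \<open>U ** D ** ctranspose U\<close> only conjugates the diagonal.\<close>

lemma diag_algebra_transpose:
  assumes "A \<in> diag_algebra U"
  shows "transpose A \<in> diag_algebra U"
proof -
  obtain D where D: "diagonal_matrix D" "map_matrix complex_of_real A = U ** D ** ctranspose U"
    using assms unfolding diag_algebra_def by blast
  have "diagonal_matrix (ctranspose D)"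
    using D(1) by (simp add: diagonal_matrix_def ctranspose_def map_matrix_def transpose_def)
  moreover have "map_matrix complex_of_real (transpose A) = U ** ctranspose D ** ctranspose U"
    by (simp add: map_matrix_of_real D(2) ctranspose_mult ctranspose_ctranspose matrix_mul_assoc)
  ultimately show ?thesis
    unfolding diag_algebra_def by blast
qed

lemma diag_algebra_mat_1:
  assumes "unitary_matrix U"
  shows "mat 1 \<in> diag_algebra U"
proof -
  have "diagonal_matrix (mat 1) \<and> map_matrix complex_of_real (mat 1) = U ** mat 1 ** ctranspose U"
    using assms by (simp add: map_matrix_of_real unitary_matrix_def) (simp add: diagonal_matrix_def mat_def)
  then show ?thesis
    unfolding diag_algebra_def by blast
qed

lemma subspace_block_space: "subspace (block_space U)"
proof (rule subspaceI)
  fix A B :: "real^('q::finite \<times> 'b::finite)^('p::finite \<times> 'b)" and c :: real and i j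
  have "block 0 i j = (0 :: real^'b^'b)" for i :: 'p and j :: 'q
    by (simp add: block_def vec_eq_iff)
  then show "(0 :: real^('q::finite \<times> 'b::finite)^('p::finite \<times> 'b)) \<in> block_space U"
    by (simp add: block_space_def subspace_0[OF subspace_diag_algebra])
  have "block (A + B) i j = block A i j + block B i j" for i :: 'p and j :: 'q
    by (simp add: block_def vec_eq_iff)
  then show "A + B \<in> block_space U" if "A \<in> block_space U" "B \<in> block_space U"
    using that by (simp add: block_space_def subspace_add[OF subspace_diag_algebra])
  have "block (c *\<^sub>R A) i j = c *\<^sub>R block A i j" for i :: 'p and j :: 'q
    by (simp add: block_def vec_eq_iff)
  then show "c *\<^sub>R A \<in> block_space U" if "A \<in> block_space U"
    using that by (simp add: block_space_def subspace_scale[OF subspace_diag_algebra])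
qed

lemma block_mult: "block (A ** B) i k = (\<Sum>j\<in>UNIV. block A i j ** block B j k)"
  by (simp add: block_def matrix_matrix_mult_def vec_eq_iff sum_component
      UNIV_Times_UNIV[symmetric] sum.cartesian_product del: UNIV_Times_UNIV)

lemma block_space_mult:
  fixes A :: "real^('q::finite \<times> 'b::finite)^('p::finite \<times> 'b)" and B :: "real^('r::finite \<times> 'b)^('q::finite \<times> 'b)"
  assumes "unitary_matrix U" and "A \<in> block_space U" and "B \<in> block_space U"
  shows "A ** B \<in> block_space U"
proof -
  have "block A i j ** block B j k \<in> diag_algebra U" for i j k
    using assms by (intro diag_algebra_mult) (simp_all add: block_space_def)
  then show ?thesis
    by (simp add: block_space_def block_mult subspace_sum[OF subspace_diag_algebra])
qed

lemma block_space_transpose: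
  assumes "A \<in> block_space U"
  shows "transpose A \<in> block_space U"
proof -
  have "block (transpose A) i j = transpose (block A j i)" for i j
    by (simp add: block_def transpose_def)
  then show ?thesis
    using assms by (simp add: block_space_def diag_algebra_transpose)
qed

lemma block_space_mat_1:
  assumes "unitary_matrix U"
  shows "(mat 1 :: real^('p::finite \<times> 'b::finite)^('p \<times> 'b)) \<in> block_space U"
proof -
  have "block (mat 1) i j = (if i = j then mat 1 else 0 :: real^'b^'b)" for i j :: 'p
    by (simp add: block_def mat_def vec_eq_iff)
  then show ?thesis
    using assms
    by (simp add: block_space_def diag_algebra_mat_1 subspace_0[OF subspace_diag_algebra])
qed

text \<open>Multiplication by an invertible element is an injective linear map of a finite-dimensional
  algebra into itself, hence hits the identity.\<close>

lemma block_space_matrix_inv: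
  fixes A :: "real^('p::finite \<times> 'b::finite)^('p::finite \<times> 'b)"
  assumes U: "unitary_matrix U" and A: "A \<in> block_space U" and inv: "invertible A"
  shows "matrix_inv A \<in> block_space U"
proof -
  let ?V = "block_space U :: (real^('p::finite \<times> 'b::finite)^('p::finite \<times> 'b)) set"
  have lin: "linear ((**) A :: real^('p::finite \<times> 'b::finite)^('p::finite \<times> 'b) \<Rightarrow> _)"
    by (simp add: bounded_linear.linear[OF
          bounded_bilinear.bounded_linear_right[OF bounded_bilinear_matrix_mult]])
  have "inj_on ((**) A) (span ?V)"
    using inv by (simp add: inj_on_def invertible_mult_left_cancel)
  then have "dim ((**) A ` ?V) = dim ?V"
    by (rule dim_image_eq[OF lin])
  moreover have "(**) A ` ?V \<subseteq> ?V"
    using U A block_space_mult by blast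
  ultimately have "(**) A ` ?V = ?V"
    by (intro subspace_dim_equal linear_subspace_image lin subspace_block_space) simp_all
  then obtain B where "B \<in> ?V" and "A ** B = mat 1"
    using block_space_mat_1[OF U] by (metis (no_types, lifting) imageE)
  then show ?thesis
    by (simp add: matrix_inv_unique)
qed

section \<open>A rational chart straightening the Stiefel manifold\<close>

text \<open>With \<open>G = transpose C ** T\<close> and \<open>H = T - C ** G\<close>, membership of \<open>T\<close> in the Stiefel
  manifold is the quadratic equation \<open>transpose G ** G + transpose H ** H = mat 1\<close>. The Cayley
  transform \<open>K\<close> with \<open>G = (mat 1 - K)\<^sup>-\<^sup>1 ** (mat 1 + K)\<close>, together with \<open>Z = H ** (mat 1 - K)\<close>,
  turns it into \<open>K + transpose K + (1/2) *\<^sub>R (transpose Z ** Z) = 0\<close>, and the shear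
  \<open>K' = K + (1/4) *\<^sub>R (transpose Z ** Z)\<close> makes it linear: \<open>K'\<close> is skew-symmetric. The chart sends
  \<open>T\<close> to \<open>C ** K' + Z\<close>, here rewritten in terms of \<open>P = (mat 1 + G)\<^sup>-\<^sup>1 = (1/2) *\<^sub>R (mat 1 - K)\<close>.
  For a single column it is the stereographic projection of the sphere from \<open>- C\<close>, extended to
  a neighbourhood in the ambient space.

  Both directions use only products, transposes and inverses of square matrices. They are therefore
  smooth, and they preserve every space of block matrices that is closed under these operations.\<close>

definition stiefel_chart_dom :: "real^'d^'n \<Rightarrow> (real^'d^'n) set" where
  "stiefel_chart_dom C = {T. invertible (mat 1 + transpose C ** T)}"

definition stiefel_chart :: "real^'d^'n \<Rightarrow> real^'d^'n \<Rightarrow> real^'d^'n" where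
  "stiefel_chart C T =
     (let P = matrix_inv (mat 1 + transpose C ** T)
      in C ** (P + transpose P - 2 *\<^sub>R mat 1 + transpose P ** (transpose T ** T - mat 1) ** P)
         + 2 *\<^sub>R (T ** P))"

text \<open>Half the part of \<open>Y\<close> orthogonal to the columns of \<open>C\<close>; on the chart image this is
  \<open>(1/2) *\<^sub>R Z\<close>.\<close>

definition half_normal :: "real^'d^'n \<Rightarrow> real^'d^'n \<Rightarrow> real^'d^'n" where
  "half_normal C Y = (1/2) *\<^sub>R (Y - C ** (transpose C ** Y))"

text \<open>Recovers \<open>P = (1/2) *\<^sub>R (mat 1 - K)\<close> from the image point by undoing the shear.\<close>

definition stiefel_chart_factor :: "real^'d^'n \<Rightarrow> real^'d^'n \<Rightarrow> real^'d^'d" where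
  "stiefel_chart_factor C Y =
     (1/2) *\<^sub>R (mat 1 - transpose C ** Y + transpose (half_normal C Y) ** half_normal C Y)"

definition stiefel_chart_cod :: "real^'d^'n \<Rightarrow> (real^'d^'n) set" where
  "stiefel_chart_cod C = {Y. invertible (stiefel_chart_factor C Y)}"

text \<open>From \<open>2 *\<^sub>R ((T + C) ** P) = 2 *\<^sub>R C + Z\<close>, solved for \<open>T\<close>.\<close>

definition stiefel_chart_inv :: "real^'d^'n \<Rightarrow> real^'d^'n \<Rightarrow> real^'d^'n" where
  "stiefel_chart_inv C Y = (C + half_normal C Y) ** matrix_inv (stiefel_chart_factor C Y) - C"

lemma stiefelD:
  assumes "C \<in> stiefel"
  shows "transpose C ** C = mat 1" and "transpose C ** (C ** X) = X"
  using assms by (simp_all add: stiefel_def matrix_mul_assoc)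

context
  fixes C T :: "real^'d^'n" and P
  assumes C: "C \<in> stiefel" and T: "T \<in> stiefel_chart_dom C"
  defines "P \<equiv> matrix_inv (mat 1 + transpose C ** T)"
begin

lemma stiefel_chart_rules:
  "transpose C ** (T ** P) = mat 1 - P"
  "transpose P ** (transpose T ** C) = mat 1 - transpose P"
  "transpose P ** (transpose T ** (C ** X)) = X - transpose P ** X"
proof -
  have "(mat 1 + transpose C ** T) ** P = mat 1"
    using T unfolding P_def stiefel_chart_dom_def by (simp add: matrix_inv_cancel)
  then show *: "transpose C ** (T ** P) = mat 1 - P"
    by (simp add: matrix_expand eq_diff_eq add.commute)
  from arg_cong[OF this, of transpose]
  show **: "transpose P ** (transpose T ** C) = mat 1 - transpose P"
    by (simp add: matrix_expand)
  have "transpose P ** (transpose T ** (C ** X)) = (transpose P ** (transpose T ** C)) ** X"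
    by (simp add: matrix_mul_assoc)
  then show "transpose P ** (transpose T ** (C ** X)) = X - transpose P ** X"
    by (simp add: ** matrix_expand)
qed

text \<open>The skew part of \<open>K'\<close> is \<open>transpose P - P\<close>, and its symmetric part is congruent to the
  defect \<open>transpose T ** T - mat 1\<close>. This identity is what makes the chart flatten the
  manifold.\<close>

lemma transpose_mult_stiefel_chart:
  "transpose C ** stiefel_chart C T =
     (transpose P - P) + transpose P ** (transpose T ** T - mat 1) ** P"
  unfolding stiefel_chart_def Let_def P_def[symmetric]
  by (simp add: matrix_expand stiefelD[OF C] stiefel_chart_rules) (simp add: vec_eq_iff)

lemma stiefel_iff_stiefel_chart_skew:
  "T \<in> stiefel \<longleftrightarrow>
     transpose (transpose C ** stiefel_chart C T) = - (transpose C ** stiefel_chart C T)"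
proof -
  let ?D = "transpose P ** (transpose T ** T - mat 1) ** P"
  have invP: "invertible P"
    using T by (simp add: P_def stiefel_chart_dom_def invertible_matrix_inv)
  have sym: "transpose ?D = ?D"
    by (simp add: matrix_expand)
  have "transpose (transpose C ** stiefel_chart C T) = - (transpose C ** stiefel_chart C T) \<longleftrightarrow>
      ?D = 0"
    unfolding transpose_mult_stiefel_chart transpose_add sym
    by (simp add: transpose_diff) (auto simp: vec_eq_iff)
  also have "\<dots> \<longleftrightarrow> transpose P ** ((transpose T ** T - mat 1) ** P) = transpose P ** 0"
    by (simp add: matrix_mul_assoc)
  also have "\<dots> \<longleftrightarrow> (transpose T ** T - mat 1) ** P = 0"
    by (rule invertible_mult_left_cancel[OF transpose_invertible[OF invP]])
  also have "\<dots> \<longleftrightarrow> transpose ((transpose T ** T - mat 1) ** P) = 0"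
    by (metis transpose_iff transpose_zero)
  also have "\<dots> \<longleftrightarrow> transpose P ** (transpose T ** T - mat 1) = transpose P ** 0"
    by (simp add: matrix_expand)
  also have "\<dots> \<longleftrightarrow> T \<in> stiefel"
    unfolding invertible_mult_left_cancel[OF transpose_invertible[OF invP]]
    by (simp add: stiefel_def)
  finally show ?thesis by simp
qed

lemma half_normal_stiefel_chart: "half_normal C (stiefel_chart C T) = T ** P + C ** P - C"
  unfolding half_normal_def transpose_mult_stiefel_chart
  unfolding stiefel_chart_def Let_def P_def[symmetric]
  by (simp add: matrix_expand vec_eq_iff field_simps)

lemma stiefel_chart_factor_stiefel_chart: "stiefel_chart_factor C (stiefel_chart C T) = P"
  unfolding stiefel_chart_factor_def half_normal_stiefel_chart transpose_mult_stiefel_chart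
  by (simp add: matrix_expand stiefelD[OF C] stiefel_chart_rules)

lemma stiefel_chart_in_cod: "stiefel_chart C T \<in> stiefel_chart_cod C"
  using T by (simp add: stiefel_chart_cod_def stiefel_chart_factor_stiefel_chart P_def
      stiefel_chart_dom_def invertible_matrix_inv)

lemma stiefel_chart_inv_stiefel_chart: "stiefel_chart_inv C (stiefel_chart C T) = T"
proof -
  have "C + (T ** P + C ** P - C) = (T + C) ** P"
    by (simp add: matrix_expand)
  moreover have "(T + C) ** P ** matrix_inv P = T + C"
    using T by (simp add: matrix_mul_assoc[symmetric] matrix_inv_cancel P_def stiefel_chart_dom_def
        invertible_matrix_inv)
  ultimately show ?thesis
    unfolding stiefel_chart_inv_def half_normal_stiefel_chart stiefel_chart_factor_stiefel_chart
    by simp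
qed

end

context
  fixes C Y :: "real^'d^'n" and T P Z
  assumes C: "C \<in> stiefel" and Y: "Y \<in> stiefel_chart_cod C"
  defines "T \<equiv> stiefel_chart_inv C Y" and "P \<equiv> stiefel_chart_factor C Y" and "Z \<equiv> half_normal C Y"
begin

lemma half_normal_rules: "transpose C ** Z = 0" "transpose Z ** C = 0" "transpose C ** (Z ** X) = 0"
  "transpose Z ** (C ** X) = 0"
proof -
  show *: "transpose C ** Z = 0"
    unfolding Z_def half_normal_def by (simp add: matrix_expand stiefelD[OF C])
  from arg_cong[OF this, of transpose] show **: "transpose Z ** C = 0"
    by (simp add: matrix_expand transpose_zero)
  show "transpose C ** (Z ** X) = 0" "transpose Z ** (C ** X) = 0"
    by (simp_all add: matrix_mul_assoc * **)
qed

text \<open>The inverse chart cleared of the matrix inverse, so that the two identities below follow by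
  expanding products.\<close>

lemma stiefel_chart_inv_mult_factor: "T ** P = C + Z - C ** P"
proof -
  have "matrix_inv P ** P = mat 1"
    using Y by (simp add: P_def stiefel_chart_cod_def matrix_inv_cancel)
  then have "(C + Z) ** matrix_inv P ** P = C + Z"
    by (simp add: matrix_mul_assoc[symmetric])
  then show ?thesis
    unfolding T_def stiefel_chart_inv_def P_def[symmetric] Z_def[symmetric]
    by (simp add: matrix_mult_diff_left)
qed

lemma one_plus_stiefel_chart_inv_mult_factor:
  "(mat 1 + transpose C ** T) ** P = mat 1"
  by (simp add: matrix_expand stiefel_chart_inv_mult_factor stiefelD[OF C] half_normal_rules)

lemma stiefel_chart_inv_in_dom: "T \<in> stiefel_chart_dom C"
  using one_plus_stiefel_chart_inv_mult_factor invertible_right_inverse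
  unfolding stiefel_chart_dom_def by blast

lemma stiefel_chart_stiefel_chart_inv: "stiefel_chart C T = Y"
proof -
  have "transpose P ** (transpose T ** T) ** P = transpose (T ** P) ** (T ** P)"
    by (simp add: matrix_expand)
  also have "\<dots> = mat 1 - P - transpose P + transpose P ** P + transpose Z ** Z"
    unfolding stiefel_chart_inv_mult_factor
    by (simp add: matrix_expand stiefelD[OF C] half_normal_rules)
  finally have "P + transpose P - 2 *\<^sub>R mat 1 + transpose P ** (transpose T ** T - mat 1) ** P =
      transpose Z ** Z - mat 1"
    by (simp add: matrix_mult_diff_left matrix_mult_diff_right) (simp add: vec_eq_iff)
  then have "stiefel_chart C T = C ** (transpose Z ** Z - mat 1) + 2 *\<^sub>R (C + Z - C ** P)"
    unfolding stiefel_chart_def matrix_inv_unique[OF one_plus_stiefel_chart_inv_mult_factor] Let_def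
    by (simp only: stiefel_chart_inv_mult_factor)
  also have "\<dots> = C ** (transpose Z ** Z + mat 1 - 2 *\<^sub>R P) + 2 *\<^sub>R Z"
    by (simp add: matrix_expand) (simp add: vec_eq_iff)
  also have "transpose Z ** Z + mat 1 - 2 *\<^sub>R P = transpose C ** Y"
    unfolding P_def stiefel_chart_factor_def Z_def by simp
  also have "C ** (transpose C ** Y) + 2 *\<^sub>R Z = Y"
    unfolding Z_def half_normal_def by simp
  finally show ?thesis .
qed

end

lemma open_invertible:
  fixes A :: "'a::euclidean_space \<Rightarrow> real^'n^'n"
  assumes "Cinf_on UNIV A"
  shows "open {x. invertible (A x)}"
proof -
  have "continuous_on UNIV (\<lambda>x. det (A x))"
    by (intro Cinf_on_imp_continuous_on Cinf_on_det open_UNIV Cinf_on_nth assms)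
  then show ?thesis
    using open_Collect_neq[of "\<lambda>x. det (A x)" "\<lambda>x. 0"] by (simp add: invertible_det_nz)
qed

lemmas Cinf_intros = Cinf_on_add Cinf_on_diff Cinf_on_scaleR Cinf_on_matrix_mult Cinf_on_transpose
  Cinf_on_const Cinf_on_id

lemma open_stiefel_chart_dom: "open (stiefel_chart_dom C)"
  unfolding stiefel_chart_dom_def by (intro open_invertible Cinf_intros open_UNIV)

lemma Cinf_on_half_normal: "open S \<Longrightarrow> Cinf_on S (half_normal C)"
  unfolding half_normal_def by (intro Cinf_intros)

lemma Cinf_on_stiefel_chart_factor: "open S \<Longrightarrow> Cinf_on S (stiefel_chart_factor C)"
  unfolding stiefel_chart_factor_def by (intro Cinf_intros Cinf_on_half_normal)

lemma open_stiefel_chart_cod: "open (stiefel_chart_cod C)"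
  unfolding stiefel_chart_cod_def
  by (intro open_invertible Cinf_on_stiefel_chart_factor open_UNIV)

lemma Cinf_on_stiefel_chart: "Cinf_on (stiefel_chart_dom C) (stiefel_chart C)"
proof -
  have "Cinf_on (stiefel_chart_dom C) (\<lambda>T. matrix_inv (mat 1 + transpose C ** T))"
    by (intro Cinf_on_matrix_inv Cinf_intros open_stiefel_chart_dom)
      (simp add: stiefel_chart_dom_def)
  then show ?thesis
    unfolding stiefel_chart_def Let_def by (intro Cinf_intros open_stiefel_chart_dom)
qed

lemma Cinf_on_stiefel_chart_inv: "Cinf_on (stiefel_chart_cod C) (stiefel_chart_inv C)"
  unfolding stiefel_chart_inv_def
  by (intro Cinf_intros Cinf_on_half_normal Cinf_on_matrix_inv Cinf_on_stiefel_chart_factor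
      open_stiefel_chart_cod) (simp add: stiefel_chart_cod_def)

section \<open>The Cayley retraction\<close>

text \<open>If \<open>A *v x = x\<close> with \<open>A\<close> skew-symmetric, then \<open>x \<bullet> x = x \<bullet> (A *v x) = 0\<close>.\<close>

lemma invertible_one_minus_skew:
  fixes A :: "real^'n^'n"
  assumes "transpose A = - A"
  shows "invertible (mat 1 - A)"
proof -
  have "x = 0" if "(mat 1 - A) *v x = 0" for x
  proof -
    have x: "A *v x = x"
      using that by (simp add: matrix_vector_mult_diff_rdistrib)
    have "(- A) *v x = - (A *v x)"
      by (simp add: matrix_vector_mult_def vec_eq_iff sum_negf)
    then have "x v* A = - x"
      using x assms by (metis transpose_matrix_vector)
    then have "x \<bullet> x = - (x \<bullet> x)"
      using dot_lmul_matrix[of x A x] x by simp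
    then show ?thesis by simp
  qed
  then show ?thesis
    using matrix_left_invertible_ker invertible_left_inverse by metis
qed

lemma transpose_half_cayley_W: "transpose ((1/2) *\<^sub>R cayley_W T X) = - ((1/2) *\<^sub>R cayley_W T X)"
  by (simp add: transpose_scalar transpose_cayley_W)

lemma Cinf_on_cayley_W:
  assumes "Cinf_on S f" and "Cinf_on S g"
  shows "Cinf_on S (\<lambda>x. cayley_W (f x) (g x))"
  unfolding cayley_W_def cayley_W_hat_def by (intro Cinf_intros assms)

lemma Cinf_on_cayley_retraction:
  assumes "Cinf_on S f" and "Cinf_on S g"
  shows "Cinf_on S (\<lambda>x. cayley_retraction (f x) (g x))"
proof -
  have "open S"
    using assms(1) by (simp add: Cinf_on_def)
  then show ?thesis
    unfolding cayley_retraction_def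
    by (intro Cinf_intros Cinf_on_matrix_inv Cinf_on_cayley_W assms invertible_one_minus_skew
        transpose_half_cayley_W)
qed

text \<open>Polynomials in \<open>A\<close> commute with each other and with \<open>(mat 1 - A)\<^sup>-\<^sup>1\<close>, and
  transposition exchanges \<open>mat 1 - A\<close> with \<open>mat 1 + A\<close>.\<close>

lemma cayley_transform_orthogonal:
  fixes A :: "real^'n^'n"
  assumes A: "transpose A = - A"
  defines "Q \<equiv> matrix_inv (mat 1 - A) ** (mat 1 + A)"
  shows "transpose Q ** Q = mat 1"
proof -
  let ?J = "matrix_inv (mat 1 - A)"
  note J = matrix_inv_cancel[OF invertible_one_minus_skew[OF A]]
  have comm: "(mat 1 - A) ** (mat 1 + A) = (mat 1 + A) ** (mat 1 - A)"
    by (simp add: matrix_expand)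
  have "Q = ?J ** ((mat 1 + A) ** (mat 1 - A)) ** ?J"
    by (simp add: Q_def J matrix_mul_assoc[symmetric])
  also have "\<dots> = (mat 1 + A) ** ?J"
    by (simp add: comm[symmetric]) (simp add: J matrix_mul_assoc)
  finally have Q: "Q = (mat 1 + A) ** ?J" .
  have "transpose Q ** Q = transpose ?J ** ((mat 1 - A) ** (mat 1 + A)) ** ?J"
    by (simp add: Q matrix_transpose_mul transpose_add A matrix_mul_assoc)
  also have "\<dots> = transpose ?J ** (mat 1 + A)"
    by (simp add: comm) (simp add: J matrix_mul_assoc[symmetric])
  also have "\<dots> = transpose ((mat 1 - A) ** ?J)"
    by (simp only: matrix_transpose_mul transpose_diff A transpose_mat) simp
  finally show ?thesis
    by (simp add: J)
qed

lemma cayley_retraction_in_stiefel: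
  assumes "T \<in> stiefel"
  shows "cayley_retraction T X \<in> stiefel"
proof -
  define Q where
    "Q = matrix_inv (mat 1 - (1/2) *\<^sub>R cayley_W T X) ** (mat 1 + (1/2) *\<^sub>R cayley_W T X)"
  have "transpose (Q ** T) ** (Q ** T) = transpose T ** (transpose Q ** Q) ** T"
    by (simp add: matrix_expand)
  also have "transpose Q ** Q = mat 1"
    unfolding Q_def by (rule cayley_transform_orthogonal[OF transpose_half_cayley_W])
  finally show ?thesis
    using assms by (simp add: stiefel_def cayley_retraction_def Q_def)
qed

lemma linear_cayley_W: "linear (cayley_W T)"
  by (rule linearI) (simp_all add: cayley_W_def cayley_W_hat_def matrix_expand algebra_simps)

lemma cayley_retraction_zero: "cayley_retraction T 0 = T"
  by (simp add: cayley_retraction_def linear_0[OF linear_cayley_W] matrix_inv_unique)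

text \<open>Smoothness provides some derivative; differentiating
  \<open>(mat 1 - A X) ** R X = (mat 1 + A X) ** T\<close>, where \<open>A\<close> is half of \<open>cayley_W T\<close> and \<open>R\<close> is the
  retraction at \<open>T\<close>, identifies it. The derivative of the matrix inverse never has to be
  computed.\<close>

lemma has_derivative_cayley_retraction:
  "(cayley_retraction T has_derivative (\<lambda>X. cayley_W T X ** T)) (at 0)"
proof -
  define A where "A X = (1/2) *\<^sub>R cayley_W T X" for X
  have A: "bounded_linear A"
    unfolding A_def
    by (intro bounded_linear_compose[OF bounded_linear_scaleR_right]
        linear_conv_bounded_linear[THEN iffD1] linear_cayley_W)
  have "cayley_retraction T differentiable (at 0)"
    by (intro Cinf_on_imp_differentiable[of UNIV] Cinf_on_cayley_retraction
        Cinf_on_const Cinf_on_id open_UNIV) simp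
  then obtain D where D: "(cayley_retraction T has_derivative D) (at 0)"
    by (auto simp: differentiable_def)
  have DA: "(A has_derivative A) (at 0)"
    by (rule bounded_linear_imp_has_derivative[OF A])
  have "((\<lambda>X. (mat 1 - A X) ** cayley_retraction T X) has_derivative
      (\<lambda>X. (mat 1 - A 0) ** D X + (0 - A X) ** cayley_retraction T 0)) (at 0)"
    by (intro bounded_bilinear.FDERIV[OF bounded_bilinear_matrix_mult] has_derivative_diff
        has_derivative_const DA D)
  moreover have "(mat 1 - A X) ** cayley_retraction T X = (mat 1 + A X) ** T" for X
    unfolding cayley_retraction_def A_def matrix_mul_assoc
    by (simp add: matrix_inv_cancel invertible_one_minus_skew transpose_half_cayley_W)
  ultimately have "((\<lambda>X. (mat 1 + A X) ** T) has_derivative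
      (\<lambda>X. (mat 1 - A 0) ** D X + (0 - A X) ** cayley_retraction T 0)) (at 0)"
    by simp
  moreover have "((\<lambda>X. (mat 1 + A X) ** T) has_derivative
      (\<lambda>X. (mat 1 + A 0) ** 0 + (0 + A X) ** T)) (at 0)"
    by (intro bounded_bilinear.FDERIV[OF bounded_bilinear_matrix_mult] has_derivative_add
        has_derivative_const DA)
  ultimately have "(\<lambda>X. (mat 1 - A 0) ** D X + (0 - A X) ** cayley_retraction T 0) =
      (\<lambda>X. (mat 1 + A 0) ** 0 + (0 + A X) ** T)"
    by (rule has_derivative_unique)
  then have "D X - A X ** T = A X ** T" for X
    by (simp add: fun_eq_iff linear_0[OF bounded_linear.linear[OF A]] cayley_retraction_zero
        matrix_expand)
  then have "D X = cayley_W T X ** T" for X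
    by (simp add: A_def diff_eq_eq matrix_mult_scaleR_left flip: scaleR_add_left)
  then show ?thesis
    using D by (metis (no_types, lifting) ext)
qed

section \<open>Tangent spaces and projections\<close>

text \<open>The linearisation at \<open>C\<close> of the equation \<open>transpose T ** T = mat 1\<close>. Both descriptions of the
  tangent space by sums \<open>C ** A + B\<close> are obtained from it by splitting off the part
  \<open>C ** (transpose C ** Y)\<close>.\<close>

definition skew_tangent :: "(real^'d^'n) set \<Rightarrow> real^'d^'n \<Rightarrow> (real^'d^'n) set" where
  "skew_tangent V C = {Y \<in> V. transpose (transpose C ** Y) = - (transpose C ** Y)}"

lemma subspace_skew_tangent: "subspace V \<Longrightarrow> subspace (skew_tangent V C)"
  by (auto simp: subspace_def skew_tangent_def matrix_expand transpose_zero
      bounded_bilinear.zero_right[OF bounded_bilinear_matrix_mult])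

lemma skew_tangent_conv_stiefel_tangent:
  assumes C: "C \<in> stiefel"
  shows "skew_tangent V C = V \<inter> stiefel_tangent C"
proof (intro equalityI subsetI)
  fix Y assume Y: "Y \<in> skew_tangent V C"
  have "Y = C ** (transpose C ** Y) + (Y - C ** (transpose C ** Y))"
    by simp
  moreover have "transpose C ** (Y - C ** (transpose C ** Y)) = 0"
    by (simp add: matrix_mult_diff_right stiefelD[OF C])
  ultimately have "Y \<in> stiefel_tangent C"
    using Y unfolding stiefel_tangent_def skew_tangent_def by blast
  then show "Y \<in> V \<inter> stiefel_tangent C"
    using Y by (simp add: skew_tangent_def)
next
  fix Y assume Y: "Y \<in> V \<inter> stiefel_tangent C"
  then obtain A B where "Y = C ** A + B" "transpose A = - A" "transpose C ** B = 0"
    unfolding stiefel_tangent_def by blast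
  then have "transpose C ** Y = A"
    by (simp add: matrix_mult_add_right stiefelD[OF C])
  then show "Y \<in> skew_tangent V C"
    using Y \<open>transpose A = - A\<close> by (simp add: skew_tangent_def)
qed

lemma skew_tangent_normal:
  assumes "transpose S = S" and "Y \<in> skew_tangent V C"
  shows "orthogonal (C ** S) Y"
  using assms inner_symmetric_skew
  by (auto simp: orthogonal_def inner_matrix_mult_right skew_tangent_def)

lemma orth_proj_eqI:
  assumes S: "subspace S" and "y \<in> S" and "\<And>z. z \<in> S \<Longrightarrow> orthogonal (x - y) z"
  shows "orth_proj S x = y"
  unfolding orth_proj_def
proof (rule the_equality)
  show "y' = y" if y': "y' \<in> S \<and> (\<forall>z\<in>S. orthogonal (x - y') z)" for y'
  proof -
    have "y' - y \<in> S"
      using S y' assms(2) by (simp add: subspace_diff)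
    then have "orthogonal (x - y) (y' - y)" "orthogonal (x - y') (y' - y)"
      using assms(3) y' by auto
    then have "(y' - y) \<bullet> (y' - y) = 0"
      by (simp add: orthogonal_def inner_diff_left)
    then show ?thesis by simp
  qed
qed (use assms in auto)

text \<open>The projection removes exactly a normal vector, namely \<open>C\<close> times the symmetric part of
  \<open>transpose C ** X\<close>.\<close>

lemma stiefel_proj_residual:
  assumes "C \<in> stiefel"
  shows "X - stiefel_proj C X =
    C ** ((1/2) *\<^sub>R (transpose C ** X + transpose (transpose C ** X)))"
  unfolding stiefel_proj_def by (simp add: matrix_expand vec_eq_iff field_simps)

lemma cayley_W_symmetric:
  assumes C: "C \<in> stiefel" and S: "transpose S = S"
  shows "cayley_W C (C ** S) = 0"
proof -
  have hat: "cayley_W_hat C (C ** S) = (1/2) *\<^sub>R (C ** (S ** transpose C))"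
    unfolding cayley_W_hat_def
    by (simp add: matrix_expand stiefelD[OF C] vec_eq_iff)
  show ?thesis
    unfolding cayley_W_def hat by (simp add: matrix_expand S)
qed

text \<open>Since \<open>cayley_W C\<close> is linear and vanishes on normal vectors, it does not see the difference
  between \<open>X\<close> and its projection.\<close>

lemma cayley_retraction_stiefel_proj:
  assumes C: "C \<in> stiefel"
  shows "cayley_retraction C (stiefel_proj C X) = cayley_retraction C X"
proof -
  have "cayley_W C (X - stiefel_proj C X) = 0"
    unfolding stiefel_proj_residual[OF C]
    by (rule cayley_W_symmetric[OF C]) (simp add: matrix_expand add.commute)
  then have "cayley_W C (stiefel_proj C X) = cayley_W C X"
    by (simp add: linear_diff[OF linear_cayley_W])
  then show ?thesis
    by (simp add: cayley_retraction_def)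
qed

lemma stiefel_proj_eq_self:
  assumes C: "C \<in> stiefel" and "X \<in> skew_tangent V C"
  shows "stiefel_proj C X = X"
  using stiefel_proj_residual[OF C, of X] assms(2) by (simp add: skew_tangent_def)

section \<open>The block Stiefel manifold\<close>

context
  fixes U :: "complex^'m^'m"
    and V M :: "(real^('m2::finite \<times> 'm)^('m1::finite \<times> 'm)) set"
  assumes U: "unitary_matrix U"
    and V: "V = block_space U"
    and M: "M = V \<inter> stiefel"
begin

lemmas block_space_simps = block_space_mult[OF U] block_space_transpose block_space_mat_1[OF U]
  subspace_add[OF subspace_block_space] subspace_diff[OF subspace_block_space]
  subspace_scale[OF subspace_block_space]

lemma stiefel_chart_in_V:
  assumes "C \<in> M" and "T \<in> V" and "T \<in> stiefel_chart_dom C"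
  shows "stiefel_chart C T \<in> V"
proof -
  have "matrix_inv (mat 1 + transpose C ** T) \<in> block_space U"
    using assms by (intro block_space_matrix_inv[OF U])
      (simp_all add: M V block_space_simps stiefel_chart_dom_def)
  then show ?thesis
    using assms by (simp add: stiefel_chart_def Let_def M V block_space_simps)
qed

lemma half_normal_in_V: "C \<in> M \<Longrightarrow> Y \<in> V \<Longrightarrow> half_normal C Y \<in> V"
  by (simp add: half_normal_def M V block_space_simps)

lemma stiefel_chart_inv_in_V:
  assumes "C \<in> M" and "Y \<in> V" and "Y \<in> stiefel_chart_cod C"
  shows "stiefel_chart_inv C Y \<in> V"
proof -
  note H = half_normal_in_V[OF assms(1,2)]
  have "matrix_inv (stiefel_chart_factor C Y) \<in> block_space U"
    using assms H by (intro block_space_matrix_inv[OF U])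
      (simp_all add: M V block_space_simps stiefel_chart_factor_def stiefel_chart_cod_def)
  then show ?thesis
    using assms H by (simp add: stiefel_chart_inv_def M V block_space_simps)
qed

lemma stiefel_chart_diffeomorphism:
  assumes "C \<in> M"
  shows "diffeomorphism (V \<inter> stiefel_chart_dom C) (V \<inter> stiefel_chart_cod C)
    (stiefel_chart C) (stiefel_chart_inv C)"
proof -
  have C: "C \<in> stiefel"
    using assms by (simp add: M)
  have "homeomorphism (V \<inter> stiefel_chart_dom C) (V \<inter> stiefel_chart_cod C)
      (stiefel_chart C) (stiefel_chart_inv C)"
  proof (rule homeomorphismI)
    show "continuous_on (V \<inter> stiefel_chart_dom C) (stiefel_chart C)"
      by (rule continuous_on_subset[OF Cinf_on_imp_continuous_on[OF Cinf_on_stiefel_chart]]) simp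
    show "continuous_on (V \<inter> stiefel_chart_cod C) (stiefel_chart_inv C)"
      by (rule continuous_on_subset[OF Cinf_on_imp_continuous_on[OF Cinf_on_stiefel_chart_inv]])
        simp
  qed (use assms C in \<open>auto simp: stiefel_chart_in_V stiefel_chart_in_cod stiefel_chart_inv_in_V
        stiefel_chart_inv_in_dom stiefel_chart_inv_stiefel_chart stiefel_chart_stiefel_chart_inv\<close>)
  moreover have "smooth_map_on (V \<inter> stiefel_chart_dom C) (stiefel_chart C)"
    by (rule smooth_map_on_if_Cinf_on[OF Cinf_on_stiefel_chart]) simp
  moreover have "smooth_map_on (V \<inter> stiefel_chart_cod C) (stiefel_chart_inv C)"
    by (rule smooth_map_on_if_Cinf_on[OF Cinf_on_stiefel_chart_inv]) simp
  ultimately show ?thesis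
    by (simp add: diffeomorphism_def)
qed

lemma stiefel_chart_flattens:
  assumes "C \<in> M"
  shows "stiefel_chart C ` (M \<inter> (V \<inter> stiefel_chart_dom C)) =
    skew_tangent V C \<inter> (V \<inter> stiefel_chart_cod C)"
proof (intro equalityI subsetI)
  have C: "C \<in> stiefel"
    using assms by (simp add: M)
  show "Y \<in> skew_tangent V C \<inter> (V \<inter> stiefel_chart_cod C)"
    if "Y \<in> stiefel_chart C ` (M \<inter> (V \<inter> stiefel_chart_dom C))" for Y
    using that assms C stiefel_iff_stiefel_chart_skew[OF C]
    by (auto simp: skew_tangent_def stiefel_chart_in_V stiefel_chart_in_cod M)
  show "Y \<in> stiefel_chart C ` (M \<inter> (V \<inter> stiefel_chart_dom C))"
    if Y: "Y \<in> skew_tangent V C \<inter> (V \<inter> stiefel_chart_cod C)" for Y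
  proof
    show *: "Y = stiefel_chart C (stiefel_chart_inv C Y)"
      using C Y by (simp add: stiefel_chart_stiefel_chart_inv)
    have dom: "stiefel_chart_inv C Y \<in> V \<inter> stiefel_chart_dom C"
      using assms C Y by (simp add: stiefel_chart_inv_in_V stiefel_chart_inv_in_dom)
    then have "stiefel_chart_inv C Y \<in> stiefel"
      using stiefel_iff_stiefel_chart_skew[OF C, of "stiefel_chart_inv C Y"] Y
      by (simp add: *[symmetric] skew_tangent_def)
    then show "stiefel_chart_inv C Y \<in> M \<inter> (V \<inter> stiefel_chart_dom C)"
      using dom by (simp add: M)
  qed
qed

text \<open>A submanifold needs one dimension for all its points, also when it is disconnected. In \<open>V\<close>, the
  orthogonal complement of the tangent space at \<open>C\<close> is the injective image under \<open>C\<close> of the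
  symmetric matrices of the square block algebra, whose dimension does not involve \<open>C\<close>.\<close>

lemma dim_skew_tangent:
  assumes "C \<in> M"
  shows "dim (skew_tangent V C) =
    dim V - dim {S :: real^('m2 \<times> 'm)^('m2 \<times> 'm). S \<in> block_space U \<and> transpose S = S}"
proof -
  define Sym where
    "Sym = {S :: real^('m2 \<times> 'm)^('m2 \<times> 'm). S \<in> block_space U \<and> transpose S = S}"
  have C: "C \<in> stiefel" "C \<in> block_space U"
    using assms by (auto simp: M V)
  have lin: "linear ((**) C :: real^('m2 \<times> 'm)^('m2 \<times> 'm) \<Rightarrow> _)"
    by (simp add: bounded_linear.linear[OF
          bounded_bilinear.bounded_linear_right[OF bounded_bilinear_matrix_mult]])
  have sub: "subspace Sym"
    unfolding Sym_def
    by (auto simp: subspace_def block_space_simps matrix_expand transpose_zero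
        subspace_0[OF subspace_block_space])
  have "inj ((**) C :: real^('m2 \<times> 'm)^('m2 \<times> 'm) \<Rightarrow> _)"
    using arg_cong[of _ _ "(**) (transpose C)"] by (intro injI) (metis stiefelD(2)[OF C(1)])
  then have dim: "dim ((**) C ` Sym) = dim Sym"
    by (rule dim_image_eq[OF lin inj_on_subset]) simp
  have "skew_tangent V C = {y \<in> V. \<forall>x \<in> (**) C ` Sym. orthogonal x y}"
  proof (intro equalityI subsetI)
    show "y \<in> {y \<in> V. \<forall>x \<in> (**) C ` Sym. orthogonal x y}" if "y \<in> skew_tangent V C" for y
    proof (intro CollectI conjI ballI)
      show "y \<in> V"
        using that by (simp add: skew_tangent_def)
      fix x assume "x \<in> (**) C ` Sym"
      then obtain S where "transpose S = S" and "x = C ** S"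
        unfolding Sym_def by blast
      then show "orthogonal x y"
        using that by (simp add: skew_tangent_normal)
    qed
  next
    fix y assume y: "y \<in> {y \<in> V. \<forall>x \<in> (**) C ` Sym. orthogonal x y}"
    \<comment> \<open>Testing \<open>y\<close> against the normal vector \<open>C ** (G + transpose G)\<close> shows that the
      symmetric part of \<open>G\<close> vanishes.\<close>
    define G where "G = transpose C ** y"
    have "G + transpose G \<in> Sym"
      using y C unfolding Sym_def G_def V
      by (simp add: block_space_simps matrix_expand add.commute)
    then have 0: "(G + transpose G) \<bullet> G = 0"
      using y unfolding G_def by (metis (mono_tags, lifting) CollectD imageI inner_matrix_mult_right
          orthogonal_def)
    moreover have "(G + transpose G) \<bullet> transpose G = (G + transpose G) \<bullet> G"
      using inner_transpose[of "G + transpose G" G] by (simp add: transpose_add add.commute)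
    ultimately have "(G + transpose G) \<bullet> (G + transpose G) = 0"
      by (simp add: inner_add_right)
    then have "transpose G = - G"
      by (simp add: eq_neg_iff_add_eq_0 add.commute)
    then show "y \<in> skew_tangent V C"
      using y by (simp add: skew_tangent_def G_def)
  qed
  moreover have "dim {y \<in> V. \<forall>x \<in> (**) C ` Sym. orthogonal x y} + dim ((**) C ` Sym) = dim V"
    using C unfolding V
    by (intro dim_subspace_orthogonal_to_vectors linear_subspace_image lin sub subspace_block_space)
      (auto simp: Sym_def block_space_simps)
  ultimately show ?thesis
    unfolding Sym_def[symmetric] dim by simp
qed

lemma embedded_submanifold_block_stiefel: "embedded_submanifold V M"
proof -
  have subV: "subspace V"
    by (simp add: V subspace_block_space)
  define k where
    "k = dim V - dim {S :: real^('m2 \<times> 'm)^('m2 \<times> 'm). S \<in> block_space U \<and> transpose S = S}"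
  have "\<exists>N N' \<phi> \<psi> L. openin (top_of_set V) N \<and> C \<in> N \<and> openin (top_of_set V) N' \<and>
      diffeomorphism N N' \<phi> \<psi> \<and> subspace L \<and> L \<subseteq> V \<and> dim L = k \<and> \<phi> ` (M \<inter> N) = L \<inter> N'"
    if C: "C \<in> M" for C
  proof (intro exI conjI)
    show "diffeomorphism (V \<inter> stiefel_chart_dom C) (V \<inter> stiefel_chart_cod C)
        (stiefel_chart C) (stiefel_chart_inv C)"
      by (rule stiefel_chart_diffeomorphism[OF C])
    show "stiefel_chart C ` (M \<inter> (V \<inter> stiefel_chart_dom C)) =
        skew_tangent V C \<inter> (V \<inter> stiefel_chart_cod C)"
      by (rule stiefel_chart_flattens[OF C])
    show "dim (skew_tangent V C) = k"
      unfolding k_def by (rule dim_skew_tangent[OF C])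
    have "(mat 1 + mat 1) ** ((1/2) *\<^sub>R mat 1) = (mat 1 :: real^('m2 \<times> 'm)^('m2 \<times> 'm))"
      by (simp add: matrix_expand flip: scaleR_add_left)
    then show "C \<in> V \<inter> stiefel_chart_dom C"
      using C invertible_right_inverse by (auto simp: stiefel_chart_dom_def M stiefelD)
    show "subspace (skew_tangent V C)"
      by (rule subspace_skew_tangent[OF subV])
    show "skew_tangent V C \<subseteq> V"
      by (auto simp: skew_tangent_def)
  qed (simp_all add: openin_open_Int open_stiefel_chart_dom open_stiefel_chart_cod)
  then show ?thesis
    unfolding embedded_submanifold_def using subV M by blast
qed

lemma cayley_retraction_in_M:
  assumes "C \<in> M" and "X \<in> V"
  shows "cayley_retraction C X \<in> M"
proof -
  have W: "cayley_W C X \<in> block_space U"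
    using assms by (simp add: cayley_W_def cayley_W_hat_def M V block_space_simps)
  have "matrix_inv (mat 1 - (1/2) *\<^sub>R cayley_W C X) \<in> block_space U"
    by (intro block_space_matrix_inv[OF U] invertible_one_minus_skew transpose_half_cayley_W)
      (simp add: W block_space_simps)
  then have "cayley_retraction C X \<in> V"
    using assms W by (simp add: cayley_retraction_def M V block_space_simps)
  then show ?thesis
    using assms cayley_retraction_in_stiefel[of C X] by (simp add: M)
qed

text \<open>Differentiating \<open>transpose (c t) ** c t = mat 1\<close> along a curve \<open>c\<close> shows one inclusion; for the
  other, the Cayley curve \<open>cayley_retraction C (t *\<^sub>R v)\<close> has velocity \<open>v\<close>.\<close>

lemma tangent_space_block_stiefel:
  assumes "C \<in> M"
  shows "tangent_space M C = skew_tangent V C"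
proof (intro equalityI subsetI)
  have C: "C \<in> stiefel"
    using assms by (simp add: M)
  {
    fix v assume "v \<in> tangent_space M C"
    then obtain c e where e: "0 < (e::real)" and cM: "c ` {-e<..<e} \<subseteq> M" and c0: "c 0 = C"
      and c: "(c has_vector_derivative v) (at 0)"
      unfolding tangent_space_def by blast
    note D = c[unfolded has_vector_derivative_def]
    have evM: "\<forall>\<^sub>F t in at 0. c t \<in> M"
      by (rule eventually_mono[OF eventually_at_in_open[of "{-e<..<e}" 0]]) (use e cM in auto)
    have "((\<lambda>h. norm (c h - C - h *\<^sub>R v) / norm h) \<longlongrightarrow> 0) (at 0)"
      using c by (simp add: has_vector_derivative_def has_derivative_at c0)
    moreover have "\<forall>\<^sub>F h in at 0. norm (c h - C - h *\<^sub>R v) / norm h = norm ((1/h) *\<^sub>R (c h - C) - v)"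
      unfolding eventually_at_filter
    proof (intro always_eventually allI impI)
      fix h :: real assume "h \<noteq> 0"
      then have "(1/h) *\<^sub>R (c h - C) - v = (1/h) *\<^sub>R (c h - C - h *\<^sub>R v)"
        by (simp add: scaleR_diff_right)
      then show "norm (c h - C - h *\<^sub>R v) / norm h = norm ((1/h) *\<^sub>R (c h - C) - v)"
        by simp
    qed
    \<comment> \<open>The difference quotients lie in the closed subspace \<open>V\<close>, hence so does the velocity.\<close>
    ultimately have "((\<lambda>h. (1/h) *\<^sub>R (c h - C)) \<longlongrightarrow> v) (at 0)"
      by (rule LIM_zero_cancel[OF tendsto_norm_zero_cancel[OF Lim_transform_eventually]])
    moreover have "\<forall>\<^sub>F h in at 0. (1/h) *\<^sub>R (c h - C) \<in> V"
      using evM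
    proof eventually_elim
      case (elim h)
      then show ?case
        using assms by (simp add: M V subspace_scale[OF subspace_block_space]
            subspace_diff[OF subspace_block_space])
    qed
    ultimately have "v \<in> V"
      using closed_subspace[OF subspace_block_space, of U] unfolding V
      by (intro Lim_in_closed_set[of _ "\<lambda>h. (1/h) *\<^sub>R (c h - C)"]) auto
    have "((\<lambda>t. transpose (c t) ** c t) has_derivative
        (\<lambda>t. transpose (c 0) ** (t *\<^sub>R v) + transpose (t *\<^sub>R v) ** c 0)) (at 0)"
      by (rule bounded_bilinear.FDERIV[OF bounded_bilinear_matrix_mult
            bounded_linear.has_derivative[OF bounded_linear_transpose D] D])
    moreover have "((\<lambda>t. transpose (c t) ** c t) has_derivative (\<lambda>t. 0)) (at 0)"
    proof (rule has_derivative_transform_within_open[OF has_derivative_const,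
          where s = "{-e<..<e}"])
      show "mat 1 = transpose (c t) ** c t" if "t \<in> {-e<..<e}" for t
        using subsetD[OF cM imageI[OF that]] by (simp add: M stiefel_def)
    qed (use e in simp_all)
    ultimately have "(\<lambda>t. transpose (c 0) ** (t *\<^sub>R v) + transpose (t *\<^sub>R v) ** c 0) = (\<lambda>t. 0)"
      by (rule has_derivative_unique)
    from fun_cong[OF this, of 1] have "transpose (transpose C ** v) = - (transpose C ** v)"
      by (simp add: c0 matrix_expand eq_neg_iff_add_eq_0 add.commute)
    then show "v \<in> skew_tangent V C"
      using \<open>v \<in> V\<close> by (simp add: skew_tangent_def)
  }
  {
    fix v assume v: "v \<in> skew_tangent V C"
    define c where "c t = cayley_retraction C (t *\<^sub>R v)" for t :: real
    have "smooth_map_on {-1<..<1} c"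
      unfolding c_def
      by (intro smooth_map_on_if_Cinf_on[of UNIV] Cinf_on_cayley_retraction Cinf_on_const
          Cinf_on_linear[OF bounded_linear_scaleR_left] Cinf_on_id open_UNIV) simp
    moreover have "c ` {-1<..<1} \<subseteq> M"
      using v subspace_scale[OF subspace_block_space]
      by (auto simp: c_def skew_tangent_def V intro!: cayley_retraction_in_M assms)
    moreover have "c 0 = C"
      by (simp add: c_def cayley_retraction_zero)
    moreover have "(c has_vector_derivative v) (at 0)"
    proof -
      have "((\<lambda>t. t *\<^sub>R v) has_derivative (\<lambda>t. t *\<^sub>R v)) (at 0)"
        by (rule bounded_linear_imp_has_derivative[OF bounded_linear_scaleR_left])
      from has_derivative_compose[OF this, of "cayley_retraction C" "\<lambda>X. cayley_W C X ** C"]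
      have "(c has_derivative (\<lambda>t. cayley_W C (t *\<^sub>R v) ** C)) (at 0)"
        using has_derivative_cayley_retraction[of C] by (simp add: c_def[abs_def])
      moreover have "cayley_W C (t *\<^sub>R v) ** C = t *\<^sub>R v" for t
        using stiefel_proj_eq_self[OF C v] stiefel_proj_eq_cayley_W[OF C, of v]
        by (simp add: linear_scale[OF linear_cayley_W] matrix_mult_scaleR_left)
      ultimately show ?thesis
        by (simp add: has_vector_derivative_def)
    qed
    ultimately show "v \<in> tangent_space M C"
      unfolding tangent_space_def using zero_less_one by blast
  }
qed

lemma skew_tangent_block_form:
  assumes "C \<in> M"
  shows "skew_tangent V C =
    {C ** A + B | (A::real^('m2 \<times> 'm)^('m2 \<times> 'm)) B.
       A \<in> block_space U \<and> B \<in> V \<and> transpose A = - A \<and> transpose C ** B = 0}"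
proof (intro equalityI subsetI)
  have C: "C \<in> stiefel" "C \<in> block_space U"
    using assms by (auto simp: M V)
  fix Y
  {
    assume Y: "Y \<in> skew_tangent V C"
    have "Y = C ** (transpose C ** Y) + (Y - C ** (transpose C ** Y))"
      by simp
    moreover have "transpose C ** (Y - C ** (transpose C ** Y)) = 0"
      by (simp add: matrix_mult_diff_right stiefelD[OF C(1)])
    moreover have "transpose C ** Y \<in> block_space U" "Y - C ** (transpose C ** Y) \<in> V"
      using Y C by (simp_all add: skew_tangent_def V block_space_simps)
    ultimately show "Y \<in> {C ** A + B | (A::real^('m2 \<times> 'm)^('m2 \<times> 'm)) B.
        A \<in> block_space U \<and> B \<in> V \<and> transpose A = - A \<and> transpose C ** B = 0}"
      using Y unfolding skew_tangent_def by blast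
  next
    assume "Y \<in> {C ** A + B | (A::real^('m2 \<times> 'm)^('m2 \<times> 'm)) B.
        A \<in> block_space U \<and> B \<in> V \<and> transpose A = - A \<and> transpose C ** B = 0}"
    then show "Y \<in> skew_tangent V C"
      using C by (auto simp: V skew_tangent_conv_stiefel_tangent stiefel_tangent_def block_space_simps)
  }
qed

lemma orth_proj_block_stiefel:
  assumes "C \<in> M" and "X \<in> V"
  shows "orth_proj (tangent_space M C) X = stiefel_proj C X"
proof -
  have C: "C \<in> stiefel"
    using assms by (simp add: M)
  define S where "S = (1/2) *\<^sub>R (transpose C ** X + transpose (transpose C ** X))"
  have S: "transpose S = S" "S \<in> block_space U"
    using assms by (simp_all add: S_def M V block_space_simps)
      (simp add: matrix_expand add.commute)
  have res: "X - stiefel_proj C X = C ** S"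
    unfolding S_def by (rule stiefel_proj_residual[OF C])
  have "stiefel_proj C X = X - C ** S"
    using res by (simp add: algebra_simps)
  then have "stiefel_proj C X \<in> skew_tangent V C"
    using assms S
    by (simp add: skew_tangent_def M V block_space_simps)
      (simp add: S_def matrix_expand stiefelD[OF C] vec_eq_iff field_simps)
  then show ?thesis
    unfolding tangent_space_block_stiefel[OF assms(1)]
    by (intro orth_proj_eqI subspace_skew_tangent)
      (simp_all add: V subspace_block_space res skew_tangent_normal[OF S(1)])
qed

lemma manifold_retraction_cayley: "manifold_retraction M cayley_retraction"
  unfolding manifold_retraction_def
proof (intro conjI ballI)
  have "Cinf_on UNIV (\<lambda>p. cayley_retraction (fst p) (snd p))"
    by (intro Cinf_on_cayley_retraction Cinf_on_linear[OF bounded_linear_fst]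
        Cinf_on_linear[OF bounded_linear_snd] Cinf_on_id open_UNIV)
  then show "smooth_map_on (tangent_bundle M) (\<lambda>(x, v). cayley_retraction x v)"
    unfolding case_prod_beta by (rule smooth_map_on_if_Cinf_on) simp
next
  fix C assume CM: "C \<in> M"
  show "cayley_retraction C v \<in> M" if "v \<in> tangent_space M C" for v
    using that CM cayley_retraction_in_M by (simp add: tangent_space_block_stiefel skew_tangent_def)
  show "cayley_retraction C 0 = C"
    by (rule cayley_retraction_zero)
  have C: "C \<in> stiefel"
    using CM by (simp add: M)
  have lin: "bounded_linear (\<lambda>X. cayley_W C X ** C)"
    by (rule bounded_linear_compose[OF
          bounded_bilinear.bounded_linear_left[OF bounded_bilinear_matrix_mult]
          linear_cayley_W[unfolded linear_conv_bounded_linear]])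
  \<comment> \<open>Off the tangent space \<open>X \<mapsto> cayley_W C X ** C\<close> is not the identity. On it, the retraction
    agrees with the corrected map below, whose derivative at \<open>0\<close> is the identity everywhere.\<close>
  have "((\<lambda>X. cayley_retraction C X - cayley_W C X ** C + X) has_derivative
      (\<lambda>X. cayley_W C X ** C - cayley_W C X ** C + X)) (at 0)"
    by (intro has_derivative_add has_derivative_diff has_derivative_ident
        has_derivative_cayley_retraction bounded_linear_imp_has_derivative lin)
  then have "((\<lambda>X. cayley_retraction C X - cayley_W C X ** C + X) has_derivative (\<lambda>X. X))
      (at 0 within tangent_space M C)"
    by (rule has_derivative_at_withinI[OF has_derivative_eq_rhs]) simp
  moreover have "cayley_W C X ** C = X" if "X \<in> tangent_space M C" for X
    using that stiefel_proj_eq_self[OF C] stiefel_proj_eq_cayley_W[OF C]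
    by (simp add: tangent_space_block_stiefel[OF CM])
  moreover have "0 \<in> tangent_space M C"
    unfolding tangent_space_block_stiefel[OF CM]
    by (intro subspace_0 subspace_skew_tangent) (simp add: V subspace_block_space)
  ultimately show "(cayley_retraction C has_derivative (\<lambda>v. v)) (at 0 within tangent_space M C)"
    by (intro has_derivative_transform[of 0 "tangent_space M C" "cayley_retraction C"
          "\<lambda>X. cayley_retraction C X - cayley_W C X ** C + X"]) simp_all
qed

end

theorem proposition6:
  fixes U :: "complex^'m^'m"
    and V12 M :: "(real^('m2::finite \<times> 'm)^('m1::finite \<times> 'm)) set"
  assumes "CARD('m1) \<ge> CARD('m2)"
    and "unitary_matrix U"
    and "V12 = block_space U"
    and "M = V12 \<inter> stiefel"
  shows "embedded_submanifold V12 M \<and>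
    (\<forall>C\<in>M.
       tangent_space M C =
         {C ** V + B | (V::real^('m2 \<times> 'm)^('m2 \<times> 'm)) B.
            V \<in> block_space U \<and> B \<in> V12 \<and> transpose V = - V \<and> transpose C ** B = 0} \<and>
       tangent_space M C = V12 \<inter> stiefel_tangent C) \<and>
    (\<forall>C\<in>M. \<forall>X\<in>V12. orth_proj (tangent_space M C) X = stiefel_proj C X) \<and>
    manifold_retraction M cayley_retraction \<and>
    (\<forall>C\<in>M. \<forall>X\<in>V12.
       cayley_retraction C X = cayley_retraction C (orth_proj (tangent_space M C) X))"
proof (intro conjI ballI)
  note facts = assms(2-4)
  show "embedded_submanifold V12 M"
    by (rule embedded_submanifold_block_stiefel[OF facts])
  show "manifold_retraction M cayley_retraction"
    by (rule manifold_retraction_cayley[OF facts])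
  fix C assume C: "C \<in> M"
  then have St: "C \<in> stiefel"
    using assms(4) by simp
  note T = tangent_space_block_stiefel[OF facts C]
  show "tangent_space M C = {C ** V + B | (V::real^('m2 \<times> 'm)^('m2 \<times> 'm)) B.
      V \<in> block_space U \<and> B \<in> V12 \<and> transpose V = - V \<and> transpose C ** B = 0}"
    unfolding T by (rule skew_tangent_block_form[OF facts C])
  show "tangent_space M C = V12 \<inter> stiefel_tangent C"
    unfolding T by (rule skew_tangent_conv_stiefel_tangent[OF St])
  fix X assume X: "X \<in> V12"
  show proj: "orth_proj (tangent_space M C) X = stiefel_proj C X"
    by (rule orth_proj_block_stiefel[OF facts C X])
  show "cayley_retraction C X = cayley_retraction C (orth_proj (tangent_space M C) X)"
    by (simp add: proj cayley_retraction_stiefel_proj[OF St])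
qed

end
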